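(* Let $n$ be a positive integer. For every $n\times n$ Lorentzian matrix $(p_{ij})$ and all indices $i,j,k,l,m\in\{1,\dots,n\}$ (not necessarily distinct) one has the pentagonal inequality \[ p_{ij}p_{ik}p_{jk}p_{ll}p_{lm}p_{mm} \le 4\, p_{il}p_{jl}p_{kl}p_{im}p_{jm}p_{km}. \] The constant $4$ is optimal when the five indices $i,j,k,l,m$ are pairwise distinct (i.e. it cannot be replaced by any smaller constant). Moreover, \[ \mathrm{BR}(\mathbb{L}_5^+)=\operatorname{Cone}\bigl(\alpha^{ijk|lm}\bigr)_{1\le i,j,k,l,m\le 5}. \]
   Context: A Lorentzian matrix is a real symmetric matrix with nonnegative entries that has at most one positive eigenvalue. $\mathbb{L}_n^+$ denotes the set of $n\times n$ Lorentzian matrices all of whose entries are positive. For a nonempty set $X$ of $n\times n$ symmetric matrices with positive entries, $\mathrm{BR}(X)$ (the cone of bounded ratios on $X$) is the set of real vectors $\alpha=(\alpha_{ij})_{1\le i\le j\le n}$ for which there is a constant $c>0$ with $\prod_{1\le i\le j\le n}p_{ij}^{\alpha_{ij}}\le c$ for all $(p_{ij})\in X$. Write $\alpha=\sum_{i\le j}\alpha_{ij}\mathbf{e}_{ij}$ with $\{\mathbf{e}_{ij}\}_{i\le j}$ the standard basis of $\mathbb{R}^{\binom{n+1}{2}}$, and set $\mathbf{e}_{ji}=\mathbf{e}_{ij}$. The pentagonal ratio is \[ \alpha^{ijk|lm}= \mathbf{e}_{ij}+\mathbf{e}_{ik}+\mathbf{e}_{jk}+\mathbf{e}_{ll}+\mathbf{e}_{lm}+\mathbf{e}_{mm}-\mathbf{e}_{il}-\mathbf{e}_{jl}-\mathbf{e}_{kl}-\mathbf{e}_{im}-\mathbf{e}_{jm}-\mathbf{e}_{km}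 \] (coefficients adding up when indices coincide). $\operatorname{Cone}(\cdot)$ denotes the set of nonnegative real linear combinations. *)

theory Defs
  imports Complex_Main "Jordan_Normal_Form.Char_Poly"
begin

(* Rows, columns and coordinates are numbered 0, ..., n - 1, as for the library type of matrices. *)

(* Eigenvalues are counted with multiplicity: "proots" is the multiset of roots of a polynomial
   with their orders, and all complex roots of the characteristic polynomial of a real symmetric
   matrix are real. *)
definition lorentzian_mats :: "nat \<Rightarrow> real mat set" where
  "lorentzian_mats n =
     {A \<in> carrier_mat n n.
        A\<^sup>T = A \<and>
        (\<forall>i<n. \<forall>j<n. 0 \<le> A $$ (i, j)) \<and>
        size (filter_mset (\<lambda>x. 0 < x) (proots (char_poly A))) \<le> 1}"

definition pos_lorentzian_mats :: "nat \<Rightarrow> real mat set" where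
  "pos_lorentzian_mats n = {A \<in> lorentzian_mats n. \<forall>i<n. \<forall>j<n. 0 < A $$ (i, j)}"

definition upper_pairs :: "nat \<Rightarrow> (nat \<times> nat) set" where
  "upper_pairs n = {(i, j). i \<le> j \<and> j < n}"

(* A real vector indexed by "upper_pairs n" is represented by the function on all pairs
   that extends it by zero. *)
definition bounded_ratios :: "nat \<Rightarrow> real mat set \<Rightarrow> (nat \<times> nat \<Rightarrow> real) set" where
  "bounded_ratios n X =
     {\<alpha>. (\<forall>q. q \<notin> upper_pairs n \<longrightarrow> \<alpha> q = 0) \<and>
         (\<exists>c>0. \<forall>A\<in>X. (\<Prod>q\<in>upper_pairs n. (A $$ q) powr (\<alpha> q)) \<le> c)}"

(* Symmetric in i and j, so that it is the standard basis vector of the unordered pair. *)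
definition basis_vec :: "nat \<Rightarrow> nat \<Rightarrow> nat \<times> nat \<Rightarrow> real" where
  "basis_vec i j = (\<lambda>q. if q = (min i j, max i j) then 1 else 0)"

definition pentagonal_ratio ::
    "nat \<Rightarrow> nat \<Rightarrow> nat \<Rightarrow> nat \<Rightarrow> nat \<Rightarrow> nat \<times> nat \<Rightarrow> real" where
  "pentagonal_ratio i j k l m = (\<lambda>q.
       basis_vec i j q + basis_vec i k q + basis_vec j k q
     + basis_vec l l q + basis_vec l m q + basis_vec m m q
     - basis_vec i l q - basis_vec j l q - basis_vec k l q
     - basis_vec i m q - basis_vec j m q - basis_vec k m q)"

definition nonneg_cone :: "('a \<Rightarrow> real) set \<Rightarrow> ('a \<Rightarrow> real) set" where
  "nonneg_cone S =
     {v. \<exists>F c. finite F \<and> F \<subseteq> S \<and> (\<forall>s\<in>F. 0 \<le> c s) \<and> v = (\<lambda>q. \<Sum>s\<in>F. c s * s q)}"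

end

(*
A symmetric matrix has at most one positive eigenvalue iff its quadratic form is nonpositive on some
hyperplane, which gives the reverse Cauchy-Schwarz inequality. In the pentagonal inequality one may
take i, j, k isotropic and project l, m onto their span; what remains is Hadamard's inequality for a
3 x 3 Gram matrix, and the constant 4 is approached by an explicit degeneration.

For the cone, rank one matrices force a bounded ratio to be orthogonal to the scalings
p_ij -> u_i u_j p_ij, and block matrices with entries 1 and t force it to be nonpositive on all cut
semimetrics. On five points the cut cone is cut out by the triangle and pentagonal inequalities, so by
the Farkas lemma such a vector is a nonnegative combination of pentagonal ratios (the triangle
inequalities being pentagonal ratios with repeated indices).
*)

theory Submission
  imports Defs "Jordan_Normal_Form.Schur_Decomposition"
begin

section \<open>Real symmetric matrices\<close>

text \<open>The obstacle in the projection step is the entry p_lm. Passing to the span of i, j, k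
  can only raise p_ll and p_mm, because the discarded components span a negative semidefinite space,
  but it may lower p_lm. The product of the three entries still does not drop, by a discriminant
  estimate on the discarded part. The 4 arises as 2 * 2: for three isotropic vectors with pairwise
  products 1, the Gram determinant is a quarter of the product of the three values of the dual form
  at the projections, while its diagonal entries multiply to the right-hand side without the 4.
  Repeated indices need no case distinction, since the computation takes place in a form on five
  formal vectors pulled back from the matrix. For the cone, ten distances against fifteen cuts of
  five points leave five parameters, the weights of the one-point cuts. Nonnegativity of the other
  ten weights becomes a packing problem on the complete graph, which the triangle and pentagonal
  inequalities make solvable.\<close>

lemma real_symmetric_eigenvector:
  fixes A :: "real mat"
  assumes A: "A \<in> carrier_mat n n" and sym: "A\<^sup>T = A" and n: "0 < n"
  shows "\<exists>v e. v \<in> carrier_vec n \<and> v \<noteq> 0\<^sub>v n \<and> A *\<^sub>v v = e \<cdot>\<^sub>v v"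
proof -
  let ?C = "map_mat complex_of_real A"
  have C: "?C \<in> carrier_mat n n" using A by simp
  have "degree (char_poly ?C) = n" using degree_monic_char_poly[OF C] by simp
  then obtain z where "poly (char_poly ?C) z = 0"
    using n fundamental_theorem_of_algebra[of "char_poly ?C"] constant_degree[of "char_poly ?C"]
    by auto
  then have z: "poly (char_poly ?C) z = 0" .
  then have "eigenvalue ?C z" using eigenvalue_root_char_poly[OF C] by simp
  then obtain x where x: "x \<in> carrier_vec n" "x \<noteq> 0\<^sub>v n" "?C *\<^sub>v x = z \<cdot>\<^sub>v x"
    using A unfolding eigenvalue_def eigenvector_def by auto
  have symij: "A $$ (i, j) = A $$ (j, i)" if "i < n" "j < n" for i j
    using A sym that by (metis carrier_matD index_transpose_mat(1))
  have row: "(\<Sum>j<n. of_real (A $$ (i, j)) * x $ j) = z * x $ i" if "i < n" for i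
  proof -
    have "(?C *\<^sub>v x) $ i = (\<Sum>j<n. of_real (A $$ (i, j)) * x $ j)"
      using A x(1) that by (simp add: scalar_prod_def atLeast0LessThan)
    then show ?thesis using x that by simp
  qed
  \<comment> \<open>\<open>N\<close> is the squared Hermitian norm of \<open>x\<close>. Symmetry of
    the real matrix lets z N be read as \<open>cnj z * N\<close>, so z is real; a real eigenvector
    is then taken afresh from the real root, not from \<open>x\<close>.\<close>
  define N where "N = (\<Sum>i<n. x $ i * cnj (x $ i))"
  have "z * N = (\<Sum>i<n. (\<Sum>j<n. of_real (A $$ (i, j)) * x $ j) * cnj (x $ i))"
    unfolding N_def sum_distrib_left by (rule sum.cong) (simp_all add: row)
  also have "\<dots> = (\<Sum>i<n. \<Sum>j<n. of_real (A $$ (i, j)) * x $ j * cnj (x $ i))"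
    by (simp add: sum_distrib_right)
  also have "\<dots> = (\<Sum>j<n. \<Sum>i<n. of_real (A $$ (i, j)) * x $ j * cnj (x $ i))"
    by (rule sum.swap)
  also have "\<dots> = (\<Sum>j<n. x $ j * cnj (\<Sum>i<n. of_real (A $$ (j, i)) * x $ i))"
    by (intro sum.cong refl)
      (simp add: sum_distrib_left symij mult.assoc mult.left_commute)
  also have "\<dots> = cnj z * N"
    unfolding N_def sum_distrib_left by (rule sum.cong) (simp_all add: row mult.left_commute)
  finally have zN: "z * N = cnj z * N" .
  have "N = of_real (\<Sum>i<n. (cmod (x $ i))\<^sup>2)"
    unfolding N_def by (simp add: complex_norm_square[symmetric])
  moreover have "(\<Sum>i<n. (cmod (x $ i))\<^sup>2) \<noteq> 0"
  proof
    assume "(\<Sum>i<n. (cmod (x $ i))\<^sup>2) = 0"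
    then have "x = 0\<^sub>v n" using x by (intro eq_vecI) (auto simp: sum_nonneg_eq_0_iff)
    with x show False by simp
  qed
  ultimately have "N \<noteq> 0" by (metis of_real_eq_0_iff)
  with zN have "z = cnj z" by simp
  then have ze: "z = of_real (Re z)" by (simp add: complex_eq_iff)
  have "char_poly ?C = map_poly of_real (char_poly A)"
    by (rule of_real_hom.char_poly_hom[OF A])
  with z ze have "poly (map_poly complex_of_real (char_poly A)) (of_real (Re z)) = 0" by metis
  then have "poly (char_poly A) (Re z) = 0" by (simp only: of_real_hom.poly_map_poly of_real_eq_0_iff)
  then have "eigenvalue A (Re z)" using eigenvalue_root_char_poly[OF A] by simp
  then show ?thesis using A unfolding eigenvalue_def eigenvector_def by auto
qed

lemma orthogonal_matrix_first_column:
  fixes v :: "real vec"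
  assumes v: "v \<in> carrier_vec n" and v0: "v \<noteq> 0\<^sub>v n" and n: "0 < n"
  shows "\<exists>U a. U \<in> carrier_mat n n \<and> U\<^sup>T * U = 1\<^sub>m n \<and> col U 0 = a \<cdot>\<^sub>v v"
proof -
  define b where "b = basis_completion v"
  define ws where "ws = gram_schmidt n b"
  interpret cof_vec_space n "TYPE(real)" .
  have lb: "length b = n" and hb: "hd b = v" and bc: "set b \<subseteq> carrier_vec n" "distinct b"
    "\<not> lin_dep (set b)"
    using basis_completion[OF v v0, folded b_def] by auto
  then obtain vs where bv: "b = v # vs" using n by (cases b) auto
  have gs: "set ws \<subseteq> carrier_vec n" "corthogonal ws" "length ws = n"
    using gram_schmidt_result[OF bc refl, folded ws_def] lb by auto
  have hdws: "hd ws = v" unfolding ws_def using gram_schmidt_hd[OF v, of vs, folded bv] .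
  have ws0: "ws ! 0 = v" using hdws gs n by (metis hd_conv_nth list.size(3) not_less0)
  have wc: "ws ! i \<in> carrier_vec n" if "i < n" for i using gs that by auto
  have orth: "(ws ! i \<bullet> ws ! j = 0) = (i \<noteq> j)" if "i < n" "j < n" for i j
    using corthogonalD[OF gs(2), of i j] gs that by simp
  have pos: "0 < ws ! i \<bullet> ws ! i" if "i < n" for i
    using orth[OF that that] by (simp add: scalar_prod_def sum_nonneg order_less_le)
  define U where "U = mat n n (\<lambda>(i, j). (ws ! j) $ i / sqrt (ws ! j \<bullet> ws ! j))"
  have U: "U \<in> carrier_mat n n" by (simp add: U_def)
  have colU: "col U j = (1 / sqrt (ws ! j \<bullet> ws ! j)) \<cdot>\<^sub>v ws ! j" if "j < n" for j
    using wc[OF that] that by (intro eq_vecI) (auto simp: U_def)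
  have "U\<^sup>T * U = 1\<^sub>m n"
  proof (rule eq_matI)
    fix i j assume "i < dim_row (1\<^sub>m n :: real mat)" "j < dim_col (1\<^sub>m n :: real mat)"
    then have ij: "i < n" "j < n" by auto
    have "(U\<^sup>T * U) $$ (i, j) = col U i \<bullet> col U j" using U ij by simp
    also have "\<dots> = ws ! i \<bullet> ws ! j / (sqrt (ws ! i \<bullet> ws ! i) * sqrt (ws ! j \<bullet> ws ! j))"
      using wc[OF ij(1)] wc[OF ij(2)] ij by (simp add: colU smult_scalar_prod_distrib[of _ n] scalar_prod_smult_distrib[of _ n])
    also have "\<dots> = 1\<^sub>m n $$ (i, j)" using orth[OF ij] pos[OF ij(1)] ij by auto
    finally show "(U\<^sup>T * U) $$ (i, j) = 1\<^sub>m n $$ (i, j)" .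
  qed (use U in auto)
  then show ?thesis using U colU[OF n] ws0 by auto
qed

section \<open>Diagonalisation and the count of positive eigenvalues\<close>

definition diagonal :: "nat \<Rightarrow> (nat \<Rightarrow> real) \<Rightarrow> real mat" where
  "diagonal n d = mat n n (\<lambda>(i, j). if i = j then d i else 0)"

lemma spectral_theorem:
  fixes A :: "real mat"
  assumes "A \<in> carrier_mat n n" "A\<^sup>T = A"
  shows "\<exists>U d. U \<in> carrier_mat n n \<and> U\<^sup>T * U = 1\<^sub>m n \<and> U\<^sup>T * A * U = diagonal n d"
  using assms
proof (induction n arbitrary: A)
  case 0
  then show ?case by (intro exI[of _ "1\<^sub>m 0"] exI[of _ "\<lambda>_. 0"]) (auto simp: diagonal_def)
next
  case (Suc n)
  note A = Suc.prems(1) and sym = Suc.prems(2)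
  obtain v e where v: "v \<in> carrier_vec (Suc n)" "v \<noteq> 0\<^sub>v (Suc n)" "A *\<^sub>v v = e \<cdot>\<^sub>v v"
    using real_symmetric_eigenvector[OF A sym zero_less_Suc] by (elim exE conjE) (rule that)
  obtain U a where U: "U \<in> carrier_mat (Suc n) (Suc n)" "U\<^sup>T * U = 1\<^sub>m (Suc n)" "col U 0 = a \<cdot>\<^sub>v v"
    using orthogonal_matrix_first_column[OF v(1,2) zero_less_Suc] by (elim exE conjE) (rule that)
  define B where "B = U\<^sup>T * A * U"
  have B: "B \<in> carrier_mat (Suc n) (Suc n)" using U A by (simp add: B_def)
  have Bsym: "B\<^sup>T = B"
    using U A sym unfolding B_def
    by (simp add: transpose_mult[of _ "Suc n" "Suc n" _ "Suc n"] assoc_mult_mat[of _ "Suc n" "Suc n" _ "Suc n" _ "Suc n"])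
  have AU: "A *\<^sub>v col U 0 = e \<cdot>\<^sub>v col U 0"
    using A v U by (simp add: mult_mat_vec[OF A v(1)] smult_smult_assoc mult.commute)
  have B0: "B $$ (i, 0) = (if i = 0 then e else 0)" if "i < Suc n" for i
  proof -
    have "B $$ (i, 0) = col U i \<bullet> (A *\<^sub>v col U 0)"
    proof -
      have "B = U\<^sup>T * (A * U)" unfolding B_def using U A by (simp add: assoc_mult_mat[of _ "Suc n" "Suc n"])
      then show ?thesis
        using U(1) A that col_mult2[OF A U(1), of 0] by (simp del: col_mult2 add: mult_mat_vec_def)
    qed
    also have "\<dots> = e * (col U i \<bullet> col U 0)"
      unfolding AU by (rule scalar_prod_smult_distrib[of _ "Suc n"]) (use U(1) that in \<open>auto intro!: carrier_vecI\<close>)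
    also have "col U i \<bullet> col U 0 = (U\<^sup>T * U) $$ (i, 0)"
      using U(1) that by simp
    finally show ?thesis using U(2) that by simp
  qed
  define C where "C = mat n n (\<lambda>(i, j). B $$ (Suc i, Suc j))"
  have C: "C \<in> carrier_mat n n" by (simp add: C_def)
  have Bs: "B $$ (i, j) = B $$ (j, i)" if "i < Suc n" "j < Suc n" for i j
    using Bsym B that by (metis carrier_matD index_transpose_mat(1))
  have Csym: "C\<^sup>T = C" by (rule eq_matI) (auto simp: C_def Bs)
  have Bblock: "B = four_block_mat (e \<cdot>\<^sub>m 1\<^sub>m 1) (0\<^sub>m 1 n) (0\<^sub>m n 1) C"
    by (rule eq_matI) (use B B0 Bs[of 0] in \<open>auto simp: C_def\<close>)
  obtain Q d where Q: "Q \<in> carrier_mat n n" "Q\<^sup>T * Q = 1\<^sub>m n" "Q\<^sup>T * C * Q = diagonal n d"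
    using Suc.IH[OF C Csym] by (elim exE conjE) (rule that)
  define R where "R = four_block_mat (1\<^sub>m 1) (0\<^sub>m 1 n) (0\<^sub>m n 1) Q"
  have R: "R \<in> carrier_mat (Suc n) (Suc n)"
    using four_block_carrier_mat[of "1\<^sub>m 1" 1 1 Q n n] Q(1) by (simp add: R_def)
  have RT: "R\<^sup>T = four_block_mat (1\<^sub>m 1) (0\<^sub>m 1 n) (0\<^sub>m n 1) Q\<^sup>T"
    unfolding R_def using Q(1) by (subst transpose_four_block_mat) auto
  have RR: "R\<^sup>T * R = 1\<^sub>m (Suc n)"
    unfolding RT unfolding R_def
    using Q by (subst mult_four_block_mat[of _ 1 1 _ n _ n _ _ 1 _ n]) (auto simp: four_block_one_mat)
  have "R\<^sup>T * B * R = four_block_mat (e \<cdot>\<^sub>m 1\<^sub>m 1) (0\<^sub>m 1 n) (0\<^sub>m n 1) (Q\<^sup>T * C * Q)"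
    unfolding RT Bblock unfolding R_def
    using Q(1) C by (simp add: mult_four_block_mat[of _ 1 1 _ n _ n _ _ 1 _ n])
  also have "\<dots> = diagonal (Suc n) (case_nat e d)"
    unfolding Q(3) by (rule eq_matI) (auto simp: diagonal_def split: nat.split)
  finally have RB: "R\<^sup>T * B * R = diagonal (Suc n) (case_nat e d)" .
  have "(U * R)\<^sup>T * (U * R) = 1\<^sub>m (Suc n)"
  proof -
    have "(U * R)\<^sup>T * (U * R) = R\<^sup>T * (U\<^sup>T * U) * R"
      using U(1) R by (simp add: transpose_mult[of _ "Suc n" "Suc n" _ "Suc n"] assoc_mult_mat[of _ "Suc n" "Suc n" _ "Suc n" _ "Suc n"])
    then show ?thesis using U(2) R RR by simp
  qed
  moreover have "(U * R)\<^sup>T * A * (U * R) = diagonal (Suc n) (case_nat e d)"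
    unfolding RB[symmetric] B_def
    using U(1) R A by (simp add: transpose_mult[of _ "Suc n" "Suc n" _ "Suc n"] assoc_mult_mat[of _ "Suc n" "Suc n" _ "Suc n" _ "Suc n"])
  moreover have "U * R \<in> carrier_mat (Suc n) (Suc n)" using U(1) R by simp
  ultimately show ?case by blast
qed

lemma char_poly_orthogonal_diagonal:
  assumes A: "A \<in> carrier_mat n n" and U: "U \<in> carrier_mat n n" "U\<^sup>T * U = 1\<^sub>m n"
    and D: "U\<^sup>T * A * U = diagonal n d"
  shows "char_poly A = (\<Prod>k<n. [:- d k, 1:])"
proof -
  have UU: "U * U\<^sup>T = 1\<^sub>m n"
    using mat_mult_left_right_inverse[of "U\<^sup>T" n U] U by simp
  have "similar_mat_wit (diagonal n d) A U\<^sup>T U"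
    by (rule similar_mat_witI[of _ _ n]) (use U UU A in \<open>auto simp: D[symmetric]\<close>)
  then have "char_poly A = char_poly (diagonal n d)"
    using char_poly_similar unfolding similar_mat_def by metis
  also have "\<dots> = (\<Prod>a\<leftarrow>diag_mat (diagonal n d). [:- a, 1:])"
    by (rule char_poly_upper_triangular[of _ n]) (auto simp: diagonal_def)
  also have "diag_mat (diagonal n d) = map d [0..<n]"
    by (auto simp: diag_mat_def diagonal_def)
  finally show ?thesis by (simp add: prod.list_conv_set_nth comp_def atLeast0LessThan)
qed

lemma proots_prod_linear: "proots (\<Prod>k<n. [:- d k, 1:]) = image_mset d (mset_set {..<n})"
  for d :: "nat \<Rightarrow> 'a::idom"
  by (subst proots_prod) (auto simp: sum_unfold_sum_mset)

definition quad_form :: "nat \<Rightarrow> real mat \<Rightarrow> (nat \<Rightarrow> real) \<Rightarrow> real" where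
  "quad_form n A x = (\<Sum>i<n. \<Sum>j<n. A $$ (i, j) * x i * x j)"

lemma quad_form_eq_scalar_prod:
  assumes "A \<in> carrier_mat n n"
  shows "quad_form n A x = vec n x \<bullet> (A *\<^sub>v vec n x)"
  using assms unfolding quad_form_def
  by (auto simp: scalar_prod_def sum_distrib_left atLeast0LessThan mult.commute mult.left_commute intro!: sum.cong)

lemma quad_form_orthogonal_diagonal:
  assumes A: "A \<in> carrier_mat n n" and U: "U \<in> carrier_mat n n" "U\<^sup>T * U = 1\<^sub>m n"
    and D: "U\<^sup>T * A * U = diagonal n d"
  shows "quad_form n A (\<lambda>i. \<Sum>k<n. U $$ (i, k) * y k) = (\<Sum>k<n. d k * (y k)\<^sup>2)"
proof -
  have v: "vec n (\<lambda>i. \<Sum>k<n. U $$ (i, k) * y k) = U *\<^sub>v vec n y"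
    using U(1) by (intro eq_vecI) (auto simp: scalar_prod_def atLeast0LessThan)
  have "quad_form n A (\<lambda>i. \<Sum>k<n. U $$ (i, k) * y k) = (U *\<^sub>v vec n y) \<bullet> (A *\<^sub>v (U *\<^sub>v vec n y))"
    using quad_form_eq_scalar_prod[OF A] v by simp
  also have "\<dots> = vec n y \<bullet> (U\<^sup>T *\<^sub>v (A *\<^sub>v (U *\<^sub>v vec n y)))"
    using U(1) A
    by (subst (2) comm_scalar_prod[of _ n], simp, simp, subst transpose_vec_mult_scalar[of _ n n])
      (auto intro!: comm_scalar_prod[of _ n])
  also have "\<dots> = vec n y \<bullet> (diagonal n d *\<^sub>v vec n y)"
    unfolding D[symmetric] using U(1) A by (simp add: assoc_mult_mat_vec[of _ n n _ n])
  also have "diagonal n d *\<^sub>v vec n y = vec n (\<lambda>k. d k * y k)"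
  proof (rule eq_vecI)
    fix k assume "k < dim_vec (vec n (\<lambda>k. d k * y k))"
    then have k: "k < n" by simp
    then have "(diagonal n d *\<^sub>v vec n y) $ k = (\<Sum>i<n. (if k = i then d k else 0) * y i)"
      by (simp add: diagonal_def scalar_prod_def atLeast0LessThan)
    also have "\<dots> = (\<Sum>i<n. if k = i then d i * y i else 0)"
      by (rule sum.cong) auto
    finally have "(diagonal n d *\<^sub>v vec n y) $ k = \<dots>" .
    then show "(diagonal n d *\<^sub>v vec n y) $ k = vec n (\<lambda>k. d k * y k) $ k" using k by simp
  qed (simp add: diagonal_def)
  also have "vec n y \<bullet> vec n (\<lambda>k. d k * y k) = (\<Sum>k<n. d k * (y k)\<^sup>2)"
    by (auto simp: scalar_prod_def atLeast0LessThan power2_eq_square intro!: sum.cong)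
  finally show ?thesis .
qed

text \<open>The hyperplane is the one orthogonal to the eigenvector of the positive eigenvalue.
  Conversely, a plane spanned by two eigenvectors with positive eigenvalues meets every hyperplane
  in a nonzero vector, where the form is positive. Unlike a count of eigenvalues, the hyperplane
  condition pulls back directly to a list of vectors with repetitions.\<close>

lemma one_positive_eigenvalue_iff:
  fixes A :: "real mat"
  assumes A: "A \<in> carrier_mat n n" and sym: "A\<^sup>T = A"
  shows "size (filter_mset (\<lambda>x. 0 < x) (proots (char_poly A))) \<le> 1 \<longleftrightarrow>
    (\<exists>h. \<forall>x. (\<Sum>i<n. h i * x i) = 0 \<longrightarrow> quad_form n A x \<le> 0)"
proof -
  obtain U d where U: "U \<in> carrier_mat n n" "U\<^sup>T * U = 1\<^sub>m n" and D: "U\<^sup>T * A * U = diagonal n d"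
    using spectral_theorem[OF A sym] by (elim exE conjE) (rule that)
  have UU: "U * U\<^sup>T = 1\<^sub>m n"
    using mat_mult_left_right_inverse[of "U\<^sup>T" n U] U by simp
  note qf = quad_form_orthogonal_diagonal[OF A U D]
  define P where "P = {k. k < n \<and> 0 < d k}"
  have finP: "finite P" by (simp add: P_def)
  have "filter_mset (\<lambda>x. 0 < x) (proots (char_poly A)) = image_mset d (mset_set P)"
    unfolding char_poly_orthogonal_diagonal[OF A U D] proots_prod_linear P_def
    by (simp add: filter_mset_image_mset filter_mset_mset_set lessThan_def)
  then have "size (filter_mset (\<lambda>x. 0 < x) (proots (char_poly A))) \<le> 1 \<longleftrightarrow> card P \<le> 1"
    by simp
  also have "\<dots> \<longleftrightarrow> (\<exists>h. \<forall>x. (\<Sum>i<n. h i * x i) = 0 \<longrightarrow> quad_form n A x \<le> 0)"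
  proof
    assume "card P \<le> 1"
    then have eq: "\<forall>a\<in>P. \<forall>b\<in>P. a = b" using card_le_Suc0_iff_eq[OF finP] by simp
    \<comment> \<open>If \<open>P\<close> is empty, \<open>p\<close> is arbitrary and may be at
      least \<open>n\<close>, whence the guard \<open>p < n\<close> in the functional below.\<close>
    define p where "p = (SOME p. p \<in> P)"
    have p: "P \<subseteq> {p}"
    proof
      fix q assume q: "q \<in> P"
      then have "p \<in> P" unfolding p_def by (rule someI)
      with eq q show "q \<in> {p}" by simp
    qed
    have "quad_form n A x \<le> 0" if h: "(\<Sum>i<n. (if p < n then U $$ (i, p) else 0) * x i) = 0" for x
    proof -
      define y where "y k = (\<Sum>j<n. U $$ (j, k) * x j)" for k
      have "(\<Sum>k<n. U $$ (i, k) * y k) = x i" if "i < n" for i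
      proof -
        have "(\<Sum>k<n. U $$ (i, k) * y k) = (\<Sum>k<n. \<Sum>j<n. U $$ (i, k) * U $$ (j, k) * x j)"
          unfolding y_def by (simp add: sum_distrib_left mult.assoc)
        also have "\<dots> = (\<Sum>j<n. \<Sum>k<n. U $$ (i, k) * U $$ (j, k) * x j)" by (rule sum.swap)
        also have "\<dots> = (\<Sum>j<n. (U * U\<^sup>T) $$ (i, j) * x j)"
          using U(1) that by (simp add: scalar_prod_def atLeast0LessThan sum_distrib_right)
        also have "\<dots> = (\<Sum>j<n. if i = j then x j else 0)"
          unfolding UU using that by (intro sum.cong) auto
        also have "\<dots> = x i" using that by simp
        finally show ?thesis .
      qed
      then have "quad_form n A x = quad_form n A (\<lambda>i. \<Sum>k<n. U $$ (i, k) * y k)"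
        unfolding quad_form_def by simp
      also have "\<dots> = (\<Sum>k<n. d k * (y k)\<^sup>2)" by (rule qf)
      also have "\<dots> \<le> 0"
      proof (rule sum_nonpos)
        fix k assume k: "k \<in> {..<n}"
        show "d k * (y k)\<^sup>2 \<le> 0"
        proof (cases "k = p")
          case True
          then have "y k = 0" using h k by (simp add: y_def)
          then show ?thesis by simp
        next
          case False
          then have "d k \<le> 0" using p k by (auto simp: P_def not_less)
          then show ?thesis by (simp add: mult_nonpos_nonneg)
        qed
      qed
      finally show ?thesis .
    qed
    then show "\<exists>h. \<forall>x. (\<Sum>i<n. h i * x i) = 0 \<longrightarrow> quad_form n A x \<le> 0"
      by (intro exI[of _ "\<lambda>i. if p < n then U $$ (i, p) else 0"] allI impI)
  next
    assume "\<exists>h. \<forall>x. (\<Sum>i<n. h i * x i) = 0 \<longrightarrow> quad_form n A x \<le> 0"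
    then obtain h where "\<forall>x. (\<Sum>i<n. h i * x i) = 0 \<longrightarrow> quad_form n A x \<le> 0" ..
    then have h: "quad_form n A x \<le> 0" if "(\<Sum>i<n. h i * x i) = 0" for x
      using that by simp
    have False if pq: "p \<in> P" "q \<in> P" "p \<noteq> q" for p q
    proof -
      define g where "g k = (\<Sum>i<n. h i * U $$ (i, k))" for k
      obtain a b where ab: "a * g p + b * g q = 0" "a \<noteq> 0 \<or> b \<noteq> 0"
      proof (cases "g p = 0 \<and> g q = 0")
        case True
        then show ?thesis using that[of 1 1] by simp
      next
        case False
        then show ?thesis using that[of "g q" "- g p"] by auto
      qed
      define y where "y k = (if k = p then a else if k = q then b else 0)" for k
      have y2: "(\<Sum>k<n. f k (y k)) = f p a + f q b" if "\<And>k. f k 0 = 0" for f :: "nat \<Rightarrow> real \<Rightarrow> real"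
      proof -
        have "(\<Sum>k<n. f k (y k)) = (\<Sum>k\<in>{p, q}. f k (y k))"
          by (rule sum.mono_neutral_right) (use pq that in \<open>auto simp: P_def y_def\<close>)
        then show ?thesis using pq by (simp add: y_def)
      qed
      have "(\<Sum>i<n. h i * (\<Sum>k<n. U $$ (i, k) * y k)) = (\<Sum>k<n. g k * y k)"
        unfolding g_def sum_distrib_left sum_distrib_right
        by (subst sum.swap) (simp add: mult.assoc)
      also have "\<dots> = 0" using ab by (subst y2) (auto simp: mult.commute)
      finally have "quad_form n A (\<lambda>i. \<Sum>k<n. U $$ (i, k) * y k) \<le> 0" by (rule h)
      moreover have "(\<Sum>k<n. d k * (y k)\<^sup>2) = d p * a\<^sup>2 + d q * b\<^sup>2" by (rule y2) simp
      moreover have "d p * a\<^sup>2 + d q * b\<^sup>2 > 0"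
        using ab(2) pq by (auto simp: P_def intro: add_pos_nonneg add_nonneg_pos)
      ultimately show False unfolding qf by simp
    qed
    then show "card P \<le> 1"
      unfolding One_nat_def card_le_Suc0_iff_eq[OF finP] by (intro ballI) (rule ccontr)
  qed
  finally show ?thesis .
qed

section \<open>The pentagonal inequality for five vectors\<close>

text \<open>By AM-GM, the minor condition on \<open>z\<close> alone bounds 2xyz by a x^2 + b y^2.
  The left side is the determinant of the symmetric matrix with diagonal a, b, c and off-diagonal
  entries z, y, x.\<close>

lemma hadamard3:
  fixes a b c x y z :: real
  assumes "0 \<le> a" "0 \<le> b" "0 \<le> c" "z\<^sup>2 \<le> a * b"
  shows "a * b * c + 2 * x * y * z - a * x\<^sup>2 - b * y\<^sup>2 - c * z\<^sup>2 \<le> a * b * c"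
proof -
  have "(2 * x * y * z)\<^sup>2 = 4 * (x * y)\<^sup>2 * z\<^sup>2" by (simp add: power2_eq_square)
  also have "\<dots> \<le> 4 * (x * y)\<^sup>2 * (a * b)" using assms by (intro mult_left_mono) auto
  also have "\<dots> \<le> (a * x\<^sup>2 + b * y\<^sup>2)\<^sup>2"
    using zero_le_power2[of "a * x\<^sup>2 - b * y\<^sup>2"] by (simp add: power2_eq_square algebra_simps)
  finally have "2 * x * y * z \<le> a * x\<^sup>2 + b * y\<^sup>2"
    by (rule power2_le_imp_le) (use assms in auto)
  moreover have "0 \<le> c * z\<^sup>2" using assms by simp
  ultimately show ?thesis by simp
qed

text \<open>Three isotropic vectors whose pairwise products are all 1 form a basis in which the dual of the
  Lorentzian form is the bilinear form below. On the diagonal it is the Heron polynomial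
  in the square roots of the arguments.\<close>

definition heron :: "real \<Rightarrow> real \<Rightarrow> real \<Rightarrow> real \<Rightarrow> real \<Rightarrow> real \<Rightarrow> real" where
  "heron x1 x2 x3 y1 y2 y3 = (x1 + x2 + x3) * (y1 + y2 + y3) / 2 - (x1 * y1 + x2 * y2 + x3 * y3)"

text \<open>Nonnegativity of \<open>heron\<close> on the diagonal says that 4 f1 f2 - (f3 - f1 -
  f2)^2 is nonnegative. Multiplying this for f and g gives the 2 x 2 minor that
  \<open>hadamard3\<close> asks for.\<close>

lemma heron_edge_bound:
  assumes nonneg: "0 \<le> f1" "0 \<le> f2" "0 \<le> g1" "0 \<le> g2"
    and f: "0 \<le> heron f1 f2 f3 f1 f2 f3" and g: "0 \<le> heron g1 g2 g3 g1 g2 g3"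
  shows "((f3 - f1 - f2) * (g3 - g1 - g2) / 4)\<^sup>2 \<le> (f1 * g1) * (f2 * g2)"
proof -
  have "(f3 - f1 - f2)\<^sup>2 \<le> 4 * (f1 * f2)" "(g3 - g1 - g2)\<^sup>2 \<le> 4 * (g1 * g2)"
    using f g unfolding heron_def by (simp_all add: power2_eq_square algebra_simps)
  then have "(f3 - f1 - f2)\<^sup>2 * (g3 - g1 - g2)\<^sup>2 \<le> (4 * (f1 * f2)) * (4 * (g1 * g2))"
    using nonneg by (intro mult_mono) auto
  then show ?thesis by (simp add: power_mult_distrib power_divide mult_ac)
qed

text \<open>Two vectors in the same half of a Lorentzian light cone have nonnegative product;
  nonnegative coordinates select the half.\<close>

lemma heron_nonneg:
  assumes nonneg: "0 \<le> f1" "0 \<le> f2" "0 \<le> g1" "0 \<le> g2"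
    and f: "0 \<le> heron f1 f2 f3 f1 f2 f3" and g: "0 \<le> heron g1 g2 g3 g1 g2 g3"
  shows "0 \<le> heron f1 f2 f3 g1 g2 g3"
proof -
  define z where "z = (f3 - f1 - f2) * (g3 - g1 - g2) / 4"
  have "(2 * z)\<^sup>2 \<le> 4 * ((f1 * g1) * (f2 * g2))"
    using heron_edge_bound[OF assms] by (simp add: z_def power_mult_distrib power_divide)
  also have "\<dots> \<le> (f1 * g2 + f2 * g1)\<^sup>2"
    using zero_le_power2[of "f1 * g2 - f2 * g1"] by (simp add: power2_eq_square algebra_simps)
  finally have "2 * z \<le> f1 * g2 + f2 * g1"
    by (rule power2_le_imp_le) (use nonneg in auto)
  then show ?thesis unfolding z_def heron_def by (simp add: field_simps)
qed

text \<open>If \<open>f\<close> and \<open>g\<close> are the linear forms \<open>B(L, -)\<close> and \<open>B(M, -)\<close>, then the symmetric bilinear form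
  \<open>(f g + g f - B(L, M) B) / 2\<close> has diagonal entries \<open>f\<^sub>i g\<^sub>i\<close> on the isotropic basis. The right-hand side
  expands its Gram determinant; \<open>a\<close> and \<open>b\<close> are half of \<open>f3 - f1 - f2\<close> and \<open>g3 - g1 - g2\<close>.\<close>

lemma heron_det:
  fixes f1 f2 a g1 g2 b :: real
  shows "(f1 * f2 - a\<^sup>2) * (g1 * g2 - b\<^sup>2) * (f1 * g2 + f2 * g1 - 2 * a * b)
    = (f1 * g1) * (f2 * g2) * ((f1 + f2 + 2 * a) * (g1 + g2 + 2 * b))
      + 2 * ((f2 + a) * (g2 + b)) * ((f1 + a) * (g1 + b)) * (a * b)
      - (f1 * g1) * ((f2 + a) * (g2 + b))\<^sup>2 - (f2 * g2) * ((f1 + a) * (g1 + b))\<^sup>2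
      - (f1 + f2 + 2 * a) * (g1 + g2 + 2 * b) * (a * b)\<^sup>2"
  by (simp add: power2_eq_square algebra_simps)

lemma heron_product_le:
  assumes nonneg: "0 \<le> f1" "0 \<le> f2" "0 \<le> f3" "0 \<le> g1" "0 \<le> g2" "0 \<le> g3"
    and f: "0 \<le> heron f1 f2 f3 f1 f2 f3" and g: "0 \<le> heron g1 g2 g3 g1 g2 g3"
  shows "heron f1 f2 f3 f1 f2 f3 * heron g1 g2 g3 g1 g2 g3 * heron f1 f2 f3 g1 g2 g3
    \<le> 4 * (f1 * f2 * f3 * (g1 * g2 * g3))"
proof -
  define a b where "a = (f3 - f1 - f2) / 2" and "b = (g3 - g1 - g2) / 2"
  have f3: "f3 = f1 + f2 + 2 * a" and g3: "g3 = g1 + g2 + 2 * b"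
    by (simp_all add: a_def b_def field_simps)
  define x y z where "x = (f2 + a) * (g2 + b)" and "y = (f1 + a) * (g1 + b)" and "z = a * b"
  have "z\<^sup>2 \<le> (f1 * g1) * (f2 * g2)"
    using heron_edge_bound[OF nonneg(1,2,4,5) f g] by (simp add: z_def a_def b_def)
  then have "(f1 * g1) * (f2 * g2) * (f3 * g3) + 2 * x * y * z
      - (f1 * g1) * x\<^sup>2 - (f2 * g2) * y\<^sup>2 - (f3 * g3) * z\<^sup>2 \<le> (f1 * g1) * (f2 * g2) * (f3 * g3)"
    by (intro hadamard3) (use nonneg in auto)
  also have "(f1 * g1) * (f2 * g2) * (f3 * g3) + 2 * x * y * z
      - (f1 * g1) * x\<^sup>2 - (f2 * g2) * y\<^sup>2 - (f3 * g3) * z\<^sup>2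
    = (f1 * f2 - a\<^sup>2) * (g1 * g2 - b\<^sup>2) * (f1 * g2 + f2 * g1 - 2 * a * b)"
    unfolding x_def y_def z_def f3 g3 heron_det ..
  finally have le: "(f1 * f2 - a\<^sup>2) * (g1 * g2 - b\<^sup>2) * (f1 * g2 + f2 * g1 - 2 * a * b)
    \<le> (f1 * g1) * (f2 * g2) * (f3 * g3)" .
  have eqs: "heron f1 f2 f3 f1 f2 f3 = 2 * (f1 * f2 - a\<^sup>2)" "heron g1 g2 g3 g1 g2 g3 = 2 * (g1 * g2 - b\<^sup>2)"
    "heron f1 f2 f3 g1 g2 g3 = f1 * g2 + f2 * g1 - 2 * a * b"
    unfolding heron_def f3 g3 by (simp_all add: power2_eq_square field_simps)
  have scale: "2 * u * (2 * v) * w = 4 * (u * v * w)" for u v w :: real by simp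
  have "heron f1 f2 f3 f1 f2 f3 * heron g1 g2 g3 g1 g2 g3 * heron f1 f2 f3 g1 g2 g3
    = 4 * ((f1 * f2 - a\<^sup>2) * (g1 * g2 - b\<^sup>2) * (f1 * g2 + f2 * g1 - 2 * a * b))"
    unfolding eqs by (rule scale)
  also have "\<dots> \<le> 4 * ((f1 * g1) * (f2 * g2) * (f3 * g3))"
    using le by simp
  finally show ?thesis by (simp add: mult_ac)
qed

text \<open>Capitals stand for the products of the projections, lower case for the true products. If
  c \<le> Q, every factor grows. Otherwise put w = sqrt (a b), k = sqrt (A B) and s = c - Q: the
  discriminant gives w + s \<le> k, and k \<le> Q gives (k - s)(Q + s) \<le> k Q, so the loss in c
  is outweighed by the gain in a b.\<close>

lemma product_le_of_negative_semidefinite: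
  fixes a b c A B Q :: real
  assumes pos: "0 < a" "0 < b" "0 < c" "0 \<le> Q"
    and le: "A * B \<le> Q\<^sup>2"
    and neg: "\<And>x y. (a - A) * x\<^sup>2 + 2 * (c - Q) * (x * y) + (b - B) * y\<^sup>2 \<le> 0"
  shows "a * b * c \<le> A * B * Q"
proof -
  have aA: "a \<le> A" using neg[of 1 0] by simp
  have bB: "b \<le> B" using neg[of 0 1] by simp
  have AB: "0 \<le> A * B" using aA bB pos by simp
  have ab: "a * b \<le> A * B" using aA bB pos by (intro mult_mono) auto
  define k where "k = sqrt (A * B)"
  define s where "s = c - Q"
  have k: "k\<^sup>2 = A * B" "0 \<le> k" using AB by (auto simp: k_def)
  have kQ: "k \<le> Q" unfolding k_def by (rule real_le_lsqrt) (use le pos AB in auto)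
  show ?thesis
  proof (cases "s \<le> 0")
    case True
    then show ?thesis using pos AB by (intro mult_mono[OF ab]) (auto simp: s_def)
  next
    case False
    then have s: "0 < s" by simp
    have disc: "s\<^sup>2 \<le> (A - a) * (B - b)"
    proof (cases "a = A")
      case True
      show ?thesis
      proof (rule ccontr)
        assume "\<not> ?thesis"
        have "2 * s * x \<le> B - b" for x using neg[of x 1] True by (simp add: s_def)
        from this[of "(B - b + 1) / (2 * s)"] s show False by simp
      qed
    next
      case False
      with aA have lt: "0 < A - a" by simp
      \<comment> \<open>The vector (s, A - a) is the critical direction of the form in its first
        variable, so testing there yields the discriminant.\<close>
      have "(a - A) * s\<^sup>2 + 2 * s * (s * (A - a)) + (b - B) * (A - a)\<^sup>2 \<le> 0"
        unfolding s_def by (rule neg)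
      then have "(A - a) * s\<^sup>2 \<le> (A - a) * ((A - a) * (B - b))"
        by (simp add: power2_eq_square algebra_simps)
      with lt show ?thesis by simp
    qed
    define w where "w = sqrt (a * b)"
    have w: "w\<^sup>2 = a * b" "0 \<le> w" using pos by (auto simp: w_def)
    have "(w + s)\<^sup>2 \<le> k\<^sup>2"
    proof -
      have ws: "w\<^sup>2 * s\<^sup>2 \<le> (a * b) * ((A - a) * (B - b))"
        unfolding w using disc pos by (intro mult_left_mono) auto
      have "(2 * w * s)\<^sup>2 \<le> (a * (B - b) + b * (A - a))\<^sup>2"
        using ws zero_le_power2[of "a * (B - b) - b * (A - a)"]
        by (simp add: power2_eq_square algebra_simps)
      then have "2 * w * s \<le> a * (B - b) + b * (A - a)"
        by (rule power2_le_imp_le) (use aA bB pos in auto)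
      then show ?thesis using disc w k by (simp add: power2_eq_square algebra_simps)
    qed
    then have "w + s \<le> k" by (rule power2_le_imp_le) (rule k(2))
    then have wk: "w \<le> k - s" by simp
    have "(k - s) * (Q + s) \<le> k * Q"
    proof -
      have "(k - s) * (Q + s) = k * Q - s * (Q - k) - s\<^sup>2" by (simp add: power2_eq_square algebra_simps)
      moreover have "0 \<le> s * (Q - k)" using s kQ by simp
      moreover have "0 \<le> s\<^sup>2" by simp
      ultimately show ?thesis by linarith
    qed
    moreover have "w * (Q + s) \<le> (k - s) * (Q + s)" using wk s pos by (intro mult_right_mono) auto
    ultimately have wQ: "w * (Q + s) \<le> k * Q" by (rule order_trans[rotated])
    have "w \<le> k" "0 \<le> w * (Q + s)" using wk s w(2) pos by auto
    then have "w * (w * (Q + s)) \<le> k * (k * Q)" by (intro mult_mono[OF _ wQ k(2)])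
    then show ?thesis using w k by (simp add: s_def power2_eq_square mult.assoc[symmetric])
  qed
qed

text \<open>The diagonal entries of the first three vectors are set to 0: a form that is nonpositive on a
  hyperplane stays so when nonnegative diagonal entries are removed.\<close>

definition form5 where
  "form5 r s t p1 p2 p3 q1 q2 q3 a b c x1 x2 x3 x4 x5 y1 y2 y3 y4 (y5::real) =
     r * (x1 * y2 + x2 * y1) + s * (x1 * y3 + x3 * y1) + t * (x2 * y3 + x3 * y2)
   + p1 * (x1 * y4 + x4 * y1) + p2 * (x2 * y4 + x4 * y2) + p3 * (x3 * y4 + x4 * y3)
   + q1 * (x1 * y5 + x5 * y1) + q2 * (x2 * y5 + x5 * y2) + q3 * (x3 * y5 + x5 * y3)
   + a * (x4 * y4) + b * (x5 * y5) + c * (x4 * y5 + x5 * y4)"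

lemma form5_pentagonal:
  fixes r s t p1 p2 p3 q1 q2 q3 a b c :: real
  defines "F \<equiv> form5 r s t p1 p2 p3 q1 q2 q3 a b c"
  assumes pos: "0 < r" "0 < s" "0 < t" "0 < a" "0 < b" "0 < c"
    and nonneg: "0 \<le> p1" "0 \<le> p2" "0 \<le> p3" "0 \<le> q1" "0 \<le> q2" "0 \<le> q3"
    and rcs: "\<And>x1 x2 x3 x4 x5 y1 y2 y3 y4 y5. 0 < F x1 x2 x3 x4 x5 x1 x2 x3 x4 x5 \<Longrightarrow>
      F x1 x2 x3 x4 x5 x1 x2 x3 x4 x5 * F y1 y2 y3 y4 y5 y1 y2 y3 y4 y5
        \<le> (F x1 x2 x3 x4 x5 y1 y2 y3 y4 y5)\<^sup>2"
  shows "r * s * t * a * c * b \<le> 4 * (p1 * p2 * p3 * q1 * q2 * q3)"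
proof -
  define T where "T = r * s * t"
  have T: "0 < T" using pos by (simp add: T_def)
  \<comment> \<open>Rescaling the first three vectors to pairwise products 1 would multiply
    \<open>p1\<close> by t / sqrt T, and so on. The extra factor sqrt T removes the roots, so that
    \<open>A\<close>, \<open>B\<close>, \<open>Q\<close> are T times the products of the
    projections.\<close>
  define f1 f2 f3 where "f1 = p1 * t" and "f2 = p2 * s" and "f3 = p3 * r"
  define g1 g2 g3 where "g1 = q1 * t" and "g2 = q2 * s" and "g3 = q3 * r"
  note fg = f1_def f2_def f3_def g1_def g2_def g3_def
  have fgpos: "0 \<le> f1" "0 \<le> f2" "0 \<le> f3" "0 \<le> g1" "0 \<le> g2" "0 \<le> g3"
    using pos nonneg by (auto simp: fg)
  define A B Q where "A = heron f1 f2 f3 f1 f2 f3" and "B = heron g1 g2 g3 g1 g2 g3"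
    and "Q = heron f1 f2 f3 g1 g2 g3"
  define l1 l2 l3 where "l1 = t * (f2 + f3 - f1)" and "l2 = s * (f1 + f3 - f2)" and "l3 = r * (f1 + f2 - f3)"
  define m1 m2 m3 where "m1 = t * (g2 + g3 - g1)" and "m2 = s * (g1 + g3 - g2)" and "m3 = r * (g1 + g2 - g3)"
  note lm = l1_def l2_def l3_def m1_def m2_def m3_def
  have L: "r * l2 + s * l3 = 2 * T * p1" "r * l1 + t * l3 = 2 * T * p2" "s * l1 + t * l2 = 2 * T * p3"
    and M: "r * m2 + s * m3 = 2 * T * q1" "r * m1 + t * m3 = 2 * T * q2" "s * m1 + t * m2 = 2 * T * q3"
    unfolding lm fg T_def by (simp_all add: algebra_simps)
  have proj: "p1 * l1 + p2 * l2 + p3 * l3 = 2 * A" "p1 * m1 + p2 * m2 + p3 * m3 = 2 * Q"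
    "q1 * l1 + q2 * l2 + q3 * l3 = 2 * Q" "q1 * m1 + q2 * m2 + q3 * m3 = 2 * B"
    unfolding lm A_def B_def Q_def heron_def fg by (simp_all add: field_simps)
  have F_span: "F y1 y2 y3 0 0 x1 x2 x3 x4 x5 = y1 * (r * x2 + s * x3 + p1 * x4 + q1 * x5)
    + y2 * (r * x1 + t * x3 + p2 * x4 + q2 * x5) + y3 * (s * x1 + t * x2 + p3 * x4 + q3 * x5)"
    for x1 x2 x3 x4 x5 y1 y2 y3
    unfolding F_def form5_def by (simp add: algebra_simps)
  have F_sum: "F y1 y2 y3 y4 y5 x1 x2 x3 x4 x5 = F y1 y2 y3 0 0 x1 x2 x3 x4 x5
    + y4 * ((p1 * x1 + p2 * x2 + p3 * x3) + a * x4 + c * x5)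
    + y5 * ((q1 * x1 + q2 * x2 + q3 * x3) + c * x4 + b * x5)" for x1 x2 x3 x4 x5 y1 y2 y3 y4 y5
    unfolding F_def form5_def by (simp add: algebra_simps)
  \<comment> \<open>\<open>l / (2 T)\<close> and \<open>m / (2 T)\<close> are the projections of the last two vectors onto the span of the
    first three, and \<open>v\<close> below is a multiple of the component orthogonal to that span.\<close>
  have neg: "(a * T - A) * x\<^sup>2 + 2 * (c * T - Q) * (x * y) + (b * T - B) * y\<^sup>2 \<le> 0" for x y
  proof -
    define v1 v2 v3 where "v1 = - (l1 * x + m1 * y)" and "v2 = - (l2 * x + m2 * y)" and "v3 = - (l3 * x + m3 * y)"
    define v4 v5 where "v4 = 2 * T * x" and "v5 = 2 * T * y"
    note v = v1_def v2_def v3_def v4_def v5_def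
    have "r * v2 + s * v3 + p1 * v4 + q1 * v5 = (2 * T * p1 - (r * l2 + s * l3)) * x + (2 * T * q1 - (r * m2 + s * m3)) * y"
      "r * v1 + t * v3 + p2 * v4 + q2 * v5 = (2 * T * p2 - (r * l1 + t * l3)) * x + (2 * T * q2 - (r * m1 + t * m3)) * y"
      "s * v1 + t * v2 + p3 * v4 + q3 * v5 = (2 * T * p3 - (s * l1 + t * l2)) * x + (2 * T * q3 - (s * m1 + t * m2)) * y"
      unfolding v by (simp_all add: algebra_simps)
    then have orth: "F y1 y2 y3 0 0 v1 v2 v3 v4 v5 = 0" for y1 y2 y3
      unfolding F_span L M by simp
    have "p1 * v1 + p2 * v2 + p3 * v3 = - (p1 * l1 + p2 * l2 + p3 * l3) * x - (p1 * m1 + p2 * m2 + p3 * m3) * y"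
      "q1 * v1 + q2 * v2 + q3 * v3 = - (q1 * l1 + q2 * l2 + q3 * l3) * x - (q1 * m1 + q2 * m2 + q3 * m3) * y"
      unfolding v by (simp_all add: algebra_simps)
    then have pv: "p1 * v1 + p2 * v2 + p3 * v3 = - 2 * A * x - 2 * Q * y"
      "q1 * v1 + q2 * v2 + q3 * v3 = - 2 * Q * x - 2 * B * y"
      unfolding proj by simp_all
    have "F v1 v2 v3 v4 v5 v1 v2 v3 v4 v5
      = 4 * T * ((a * T - A) * x\<^sup>2 + 2 * (c * T - Q) * (x * y) + (b * T - B) * y\<^sup>2)"
      unfolding F_sum[of v1 v2 v3 v4 v5] orth pv unfolding v4_def v5_def by (simp add: power2_eq_square algebra_simps)
    \<comment> \<open>The sum of the first two vectors is positive and orthogonal to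
      \<open>v\<close>, so the reverse Cauchy-Schwarz inequality makes the form nonpositive at
      \<open>v\<close>.\<close>
    moreover have "F 1 1 0 0 0 1 1 0 0 0 = 2 * r" by (simp add: F_def form5_def)
    ultimately have "2 * r * (4 * T * ((a * T - A) * x\<^sup>2 + 2 * (c * T - Q) * (x * y) + (b * T - B) * y\<^sup>2)) \<le> 0"
      using rcs[of 1 1 0 0 0 v1 v2 v3 v4 v5] pos orth[of 1 1 0] by simp
    then show ?thesis using pos T by (simp add: mult_le_0_iff zero_le_mult_iff)
  qed
  have A: "0 < A"
  proof (rule less_le_trans)
    show "0 < a * T" using pos T by simp
    show "a * T \<le> A" using neg[of 1 0] by simp
  qed
  have B: "0 < B"
  proof (rule less_le_trans)
    show "0 < b * T" using pos T by simp
    show "b * T \<le> B" using neg[of 0 1] by simp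
  qed
  have Qsq: "A * B \<le> Q\<^sup>2"
  proof -
    have "F y1 y2 y3 0 0 l1 l2 l3 0 0 = 2 * T * (p1 * y1 + p2 * y2 + p3 * y3)"
      "F y1 y2 y3 0 0 m1 m2 m3 0 0 = 2 * T * (q1 * y1 + q2 * y2 + q3 * y3)" for y1 y2 y3
      unfolding F_span mult_zero_right add_0_right L M by (simp_all add: algebra_simps)
    then have "F l1 l2 l3 0 0 l1 l2 l3 0 0 = 4 * T * A" "F m1 m2 m3 0 0 m1 m2 m3 0 0 = 4 * T * B"
      "F l1 l2 l3 0 0 m1 m2 m3 0 0 = 4 * T * Q"
      by (simp_all add: proj)
    then have "4 * T * A * (4 * T * B) \<le> (4 * T * Q)\<^sup>2"
      using rcs[of l1 l2 l3 0 0 m1 m2 m3 0 0] T A by simp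
    then have "(4 * T)\<^sup>2 * (A * B) \<le> (4 * T)\<^sup>2 * Q\<^sup>2" by (simp add: power2_eq_square mult_ac)
    then show ?thesis using T by simp
  qed
  have Q: "0 \<le> Q"
    unfolding Q_def by (rule heron_nonneg) (use fgpos A B in \<open>auto simp: A_def B_def\<close>)
  have "(a * T) * (b * T) * (c * T) \<le> A * B * Q"
    by (rule product_le_of_negative_semidefinite) (use pos T Q Qsq neg in auto)
  also have "\<dots> \<le> 4 * (f1 * f2 * f3 * (g1 * g2 * g3))"
    unfolding A_def B_def Q_def by (rule heron_product_le) (use fgpos A B in \<open>auto simp: A_def B_def\<close>)
  finally have "T\<^sup>2 * (r * s * t * a * c * b) \<le> T\<^sup>2 * (4 * (p1 * p2 * p3 * q1 * q2 * q3))"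
    by (simp add: fg T_def power2_eq_square mult_ac)
  then show ?thesis using T by simp
qed

section \<open>Cuts on five points\<close>

text \<open>The hypotheses on \<sigma> are the upper bounds for x + y + z obtained by covering the
  variables with constraints, and greedy choice shows that there is no other obstruction: take
  \<open>x\<close> as small as the target allows, then \<open>y\<close> and \<open>z\<close> as
  large as possible.\<close>

lemma three_variable_packing:
  fixes m1 m2 m3 w12 w13 w23 \<sigma> :: real
  assumes "0 \<le> m1" "0 \<le> m2" "0 \<le> m3" "0 \<le> w12" "0 \<le> w13" "0 \<le> w23"
    and "\<sigma> \<le> m1 + m2 + m3"
    and "\<sigma> \<le> m1 + w23" "\<sigma> \<le> m2 + w13" "\<sigma> \<le> m3 + w12"
    and "\<sigma> \<le> w12 + w13" "\<sigma> \<le> w12 + w23" "\<sigma> \<le> w13 + w23"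
    and "2 * \<sigma> \<le> w12 + w13 + w23"
  shows "\<exists>x y z. 0 \<le> x \<and> x \<le> m1 \<and> 0 \<le> y \<and> y \<le> m2 \<and> 0 \<le> z \<and> z \<le> m3 \<and>
    x + y \<le> w12 \<and> x + z \<le> w13 \<and> y + z \<le> w23 \<and> \<sigma> \<le> x + y + z"
proof -
  define x where "x = max 0 (max (\<sigma> - w23) (\<sigma> - m2 - m3))"
  have x: "0 \<le> x" "\<sigma> - w23 \<le> x" "\<sigma> - m2 - m3 \<le> x"
    "x = 0 \<or> x = \<sigma> - w23 \<or> x = \<sigma> - m2 - m3"
    unfolding x_def by linarith+
  then have x': "x \<le> m1" "x \<le> w12" "x \<le> w13" "x \<le> w12 + w13 - \<sigma>"
    unfolding x_def using assms by linarith+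
  define y where "y = min m2 (min (w12 - x) w23)"
  have y: "y \<le> m2" "y \<le> w12 - x" "y \<le> w23" "y = m2 \<or> y = w12 - x \<or> y = w23"
    unfolding y_def by linarith+
  define z where "z = min m3 (min (w13 - x) (w23 - y))"
  have z: "z \<le> m3" "z \<le> w13 - x" "z \<le> w23 - y" "z = m3 \<or> z = w13 - x \<or> z = w23 - y"
    unfolding z_def by linarith+
  have "0 \<le> y" unfolding y_def using x' assms by linarith
  moreover have "0 \<le> z" unfolding z_def using x' y(3) assms by linarith
  moreover have "\<sigma> \<le> x + y + z"
    using y(4) z(4) by (elim disjE) (use x(1-3) x' assms in linarith)+
  ultimately show ?thesis using x(1) x'(1) y(1-3) z(1-3)
    by (intro exI[of _ x] exI[of _ y] exI[of _ z]) auto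
qed

lemma five_elements:
  assumes "card V = 5" "x \<in> V" "y \<in> V" "x \<noteq> y"
  obtains k l m where "V = {x, y, k, l, m}" "distinct [x, y, k, l, m]"
proof -
  have fin: "finite V" by (rule card_ge_0_finite) (simp add: assms(1))
  have "card (V - {x, y}) = 3" using fin assms by (simp add: card_Diff_subset)
  then obtain k l m where klm: "V - {x, y} = {k, l, m}" "k \<noteq> l" "k \<noteq> m" "l \<noteq> m"
    unfolding card_3_iff by (elim exE conjE) (rule that)
  have "k \<in> V - {x, y}" "l \<in> V - {x, y}" "m \<in> V - {x, y}" by (simp_all add: klm(1))
  then have "distinct [x, y, k, l, m]" using klm(2-4) assms(4) by auto
  moreover have "V = {x, y} \<union> (V - {x, y})" using assms(2,3) by blast
  then have "V = {x, y, k, l, m}" unfolding klm(1) Un_insert_left Un_empty_left .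
  ultimately show ?thesis by (intro that)
qed

text \<open>It suffices to have \<open>sum s V \<ge> 3 \<theta>\<close> and \<open>s x + s y \<le> c x y + \<theta>\<close>, with \<open>\<theta>\<close> as small as the lower bounds in \<open>M\<close> allow. If a pair \<open>x, y\<close>
  determines \<open>\<theta>\<close>, then \<open>s\<close> vanishes there and three unknowns are left; if a star at \<open>x\<close>
  determines \<open>\<theta>\<close>, then \<open>s y = c x y + \<theta>\<close> works.\<close>

lemma five_vertex_packing:
  fixes c :: "'a \<Rightarrow> 'a \<Rightarrow> real"
  assumes card: "card V = 5" and sym: "\<And>x y. c x y = c y x"
    and tri: "\<And>a b d e f. {a, b, d, e, f} \<subseteq> V \<Longrightarrow> distinct [a, b, d, e, f] \<Longrightarrow>
      0 \<le> c a b + c a d + c e f"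
    and pent: "\<And>a b d e f. {a, b, d, e, f} \<subseteq> V \<Longrightarrow> distinct [a, b, d, e, f] \<Longrightarrow>
      0 \<le> 3 * c a b + c d e + c d f + c e f"
  shows "\<exists>s. (\<forall>x\<in>V. 0 \<le> s x) \<and>
    (\<forall>x\<in>V. \<forall>y\<in>V. x \<noteq> y \<longrightarrow> s x + s y \<le> c x y + sum s V / 3)"
proof -
  have fin: "finite V" by (rule card_ge_0_finite) (simp add: card)
  \<comment> \<open>Apart from 0, the elements are bounds that any solution forces on \<theta>. A
    pair forces \<theta> \<ge> \<open>- c x y\<close>, since \<open>s x + s y\<close> is
    nonnegative. Adding the constraints on the four pairs at \<open>x\<close> gives 3 s x + sum s V
    \<le> (star sum) + 4 \<theta>, and \<open>sum s V\<close> is to be at least 3 \<theta>, so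
    \<theta> is at least minus the star sum.\<close>
  define M where "M = insert 0 ((\<lambda>(x, y). - c x y) ` {(x, y) \<in> V \<times> V. x \<noteq> y} \<union>
    (\<lambda>x. - (\<Sum>y\<in>V - {x}. c x y)) ` V)"
  have finM: "finite M"
    unfolding M_def using fin by (auto intro: finite_subset[of _ "V \<times> V"])
  define \<theta> where "\<theta> = Max M"
  have ge: "r \<le> \<theta>" if "r \<in> M" for r using that finM by (simp add: \<theta>_def)
  have \<theta>0: "0 \<le> \<theta>" by (rule ge) (simp add: M_def)
  have \<theta>c: "0 \<le> c x y + \<theta>" if "x \<in> V" "y \<in> V" "x \<noteq> y" for x y
    using ge[of "- c x y"] that by (force simp: M_def)
  have \<theta>s: "0 \<le> (\<Sum>y\<in>V - {x}. c x y) + \<theta>" if "x \<in> V" for x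
    using ge[of "- (\<Sum>y\<in>V - {x}. c x y)"] that by (force simp: M_def)
  have "\<theta> \<in> M" unfolding \<theta>_def by (rule Max_in[OF finM]) (simp add: M_def)
  then consider "\<theta> = 0" | x y where "x \<in> V" "y \<in> V" "x \<noteq> y" "\<theta> = - c x y"
    | x where "x \<in> V" "\<theta> = - (\<Sum>y\<in>V - {x}. c x y)"
    unfolding M_def by auto
  then have "\<exists>s. (\<forall>x\<in>V. 0 \<le> s x) \<and>
    (\<forall>x\<in>V. \<forall>y\<in>V. x \<noteq> y \<longrightarrow> s x + s y \<le> c x y + \<theta>) \<and> 3 * \<theta> \<le> sum s V"
  proof cases
    case 1
    then show ?thesis using \<theta>c by (intro exI[of _ "\<lambda>_. 0"]) auto
  next
    case (2 x y)
    obtain k l m where V: "V = {x, y, k, l, m}" and dist: "distinct [x, y, k, l, m]"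
      by (rule five_elements[OF card 2(1) 2(2) 2(3)])
    have mem: "x \<in> V" "y \<in> V" "k \<in> V" "l \<in> V" "m \<in> V" by (simp_all add: V)
    have "V - {x} = {y, k, l, m}" "V - {y} = {x, k, l, m}" unfolding V using dist by auto
    then have "(\<Sum>z\<in>V - {x}. c x z) = c x y + c x k + c x l + c x m"
      "(\<Sum>z\<in>V - {y}. c y z) = c x y + c y k + c y l + c y m"
      using dist sym[of y x] by simp_all
    then have star: "0 \<le> c x k + c x l + c x m" "0 \<le> c y k + c y l + c y m"
      using \<theta>s[OF mem(1)] \<theta>s[OF mem(2)] 2(4) by simp_all
    have mixed: "0 \<le> c x k + c x l + c y m" "0 \<le> c x k + c x m + c y l" "0 \<le> c x l + c x m + c y k" "0 \<le> c y k + c y l + c x m" "0 \<le> c y k + c y m + c x l" "0 \<le> c y l + c y m + c x k"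
      by (rule tri; use mem dist in auto)+
    have matched: "0 \<le> c x y + c x k + c l m" "0 \<le> c y x + c y k + c l m" "0 \<le> c x y + c x l + c k m" "0 \<le> c y x + c y l + c k m" "0 \<le> c x y + c x m + c k l" "0 \<le> c y x + c y m + c k l"
      by (rule tri; use mem dist in auto)+
    note matched = matched[unfolded sym[of y x]]
    have opposite: "0 \<le> c k l + c k m + c x y" "0 \<le> c l k + c l m + c x y" "0 \<le> c m k + c m l + c x y"
      by (rule tri; use mem dist in auto)+
    note opposite = opposite[unfolded sym[of l k] sym[of m k] sym[of m l]]
    have triangle: "0 \<le> 3 * c x y + c k l + c k m + c l m"
      by (rule pent; use mem dist in auto)
    define mu where "mu z = min (c x z) (c y z) + \<theta>" for z
    have "\<exists>a b d. 0 \<le> a \<and> a \<le> mu k \<and> 0 \<le> b \<and> b \<le> mu l \<and> 0 \<le> d \<and> d \<le> mu m \<and>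
      a + b \<le> c k l + \<theta> \<and> a + d \<le> c k m + \<theta> \<and> b + d \<le> c l m + \<theta> \<and> 3 * \<theta> \<le> a + b + d"
    proof (rule three_variable_packing)
      have "0 \<le> c x k + \<theta>" "0 \<le> c x l + \<theta>" "0 \<le> c x m + \<theta>"
        "0 \<le> c y k + \<theta>" "0 \<le> c y l + \<theta>" "0 \<le> c y m + \<theta>"
        by (rule \<theta>c; use mem dist in auto)+
      then show "0 \<le> mu k" "0 \<le> mu l" "0 \<le> mu m" by (simp_all add: mu_def min_def)
      show "0 \<le> c k l + \<theta>" "0 \<le> c k m + \<theta>" "0 \<le> c l m + \<theta>"
        by (rule \<theta>c; use mem dist in auto)+
      show "3 * \<theta> \<le> mu k + mu l + mu m"
        unfolding mu_def using mixed star by linarith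
      show "3 * \<theta> \<le> mu k + (c l m + \<theta>)" "3 * \<theta> \<le> mu l + (c k m + \<theta>)" "3 * \<theta> \<le> mu m + (c k l + \<theta>)"
        unfolding mu_def using matched 2(4) by linarith+
      show "3 * \<theta> \<le> c k l + \<theta> + (c k m + \<theta>)" "3 * \<theta> \<le> c k l + \<theta> + (c l m + \<theta>)"
        "3 * \<theta> \<le> c k m + \<theta> + (c l m + \<theta>)" "2 * (3 * \<theta>) \<le> c k l + \<theta> + (c k m + \<theta>) + (c l m + \<theta>)"
        using opposite triangle 2(4) by linarith+
    qed
    then obtain a b d where abd: "0 \<le> a" "a \<le> mu k" "0 \<le> b" "b \<le> mu l" "0 \<le> d" "d \<le> mu m"
      "a + b \<le> c k l + \<theta>" "a + d \<le> c k m + \<theta>" "b + d \<le> c l m + \<theta>" "3 * \<theta> \<le> a + b + d" by (elim exE conjE) (rule that)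
    define s where "s = (\<lambda>_. 0)(k := a, l := b, m := d)"
    have s: "s x = 0" "s y = 0" "s k = a" "s l = b" "s m = d" using dist by (auto simp: s_def)
    have mu: "mu z \<le> c x z + \<theta>" "mu z \<le> c y z + \<theta>" for z by (auto simp: mu_def)
    have R: "s x + s y \<le> c x y + \<theta>" "s x + s k \<le> c x k + \<theta>" "s x + s l \<le> c x l + \<theta>"
      "s x + s m \<le> c x m + \<theta>" "s y + s k \<le> c y k + \<theta>" "s y + s l \<le> c y l + \<theta>"
      "s y + s m \<le> c y m + \<theta>" "s k + s l \<le> c k l + \<theta>" "s k + s m \<le> c k m + \<theta>"
      "s l + s m \<le> c l m + \<theta>"
      using s abd mu[of k] mu[of l] mu[of m] 2(4) by linarith+
    have swap: "s v + s u \<le> c v u + \<theta>" if "s u + s v \<le> c u v + \<theta>" for u v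
      using that sym[of u v] by simp
    have "s u + s v \<le> c u v + \<theta>" if "u \<in> V" "v \<in> V" "u \<noteq> v" for u v
      using that unfolding V by (elim insertE emptyE) (simp_all only: R R[THEN swap] simp_thms)
    moreover have "0 \<le> s u" for u using abd by (simp add: s_def)
    moreover have "3 * \<theta> \<le> sum s V" unfolding V using dist s abd by simp
    ultimately show ?thesis by (intro exI[of _ s] conjI ballI impI)
  next
    case (3 x)
    define s where "s y = (if y = x then 0 else c x y + \<theta>)" for y
    have "s u + s v \<le> c u v + \<theta>" if uv: "u \<in> V" "v \<in> V" "u \<noteq> v" for u v
    proof (cases "u = x \<or> v = x")
      case True
      then show ?thesis using uv by (auto simp: s_def sym)
    next
      case False
      then have "x \<noteq> u" "x \<noteq> v" by auto
      then have "card (V - {x, u, v}) = 2" using fin card uv 3(1) by (simp add: card_Diff_subset)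
      then obtain k l where kl: "V - {x, u, v} = {k, l}" "k \<noteq> l" by (auto simp: card_2_iff)
      then have "k \<in> V - {x, u, v}" "l \<in> V - {x, u, v}" by simp_all
      then have dist: "distinct [x, u, v, k, l]"
        using kl(2) uv(3) \<open>x \<noteq> u\<close> \<open>x \<noteq> v\<close> by auto
      have "V = {x, u, v} \<union> (V - {x, u, v})" using uv 3(1) by blast
      then have V: "V = {x, u, v, k, l}" unfolding kl(1) Un_insert_left Un_empty_left .
      have "V - {x} = {u, v, k, l}" unfolding V using dist by auto
      then have "\<theta> = - (c x u + c x v + c x k + c x l)" using 3(2) dist by simp
      moreover have "0 \<le> c x k + c x l + c u v"
        by (rule tri) (simp add: V, use dist in auto)
      ultimately show ?thesis using dist by (auto simp: s_def)
    qed
    moreover have "0 \<le> s u" if "u \<in> V" for u using \<theta>c[of x u] 3 that by (simp add: s_def)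
    moreover have "3 * \<theta> \<le> sum s V"
    proof -
      have "sum s V = s x + (\<Sum>y\<in>V - {x}. s y)" using fin 3(1) by (simp add: sum.remove)
      also have "(\<Sum>y\<in>V - {x}. s y) = (\<Sum>y\<in>V - {x}. c x y + \<theta>)" by (rule sum.cong) (auto simp: s_def)
      also have "\<dots> = (\<Sum>y\<in>V - {x}. c x y) + 4 * \<theta>"
        using 3(1) fin card by (simp add: sum.distrib card_Diff_subset)
      also have "\<dots> = 3 * \<theta>" using 3(2) by simp
      finally show ?thesis by (simp add: s_def)
    qed
    ultimately show ?thesis by (intro exI[of _ s] conjI ballI impI)
  qed
  then obtain s where s: "\<forall>x\<in>V. 0 \<le> s x" "\<forall>x\<in>V. \<forall>y\<in>V. x \<noteq> y \<longrightarrow> s x + s y \<le> c x y + \<theta>"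
    "3 * \<theta> \<le> sum s V" by (elim exE conjE) (rule that)
  have "s x + s y \<le> c x y + sum s V / 3" if "x \<in> V" "y \<in> V" "x \<noteq> y" for x y
    using s(2)[rule_format, OF that] s(3) by linarith
  then show ?thesis by (intro exI[of _ s] conjI s(1) ballI impI)
qed

text \<open>Bartl's induction: if a vector \<open>z\<close> violates the implication without the constraint \<open>k\<close>, then
  project all functionals along \<open>z\<close> onto those that vanish at \<open>z\<close>.\<close>

lemma farkas:
  fixes a :: "'i \<Rightarrow> 'a \<Rightarrow> real" and v :: "'a \<Rightarrow> real"
  assumes U: "finite U" and "finite I"
    and "\<And>w. (\<And>i. i \<in> I \<Longrightarrow> (\<Sum>q\<in>U. a i q * w q) \<le> 0) \<Longrightarrow> (\<Sum>q\<in>U. v q * w q) \<le> 0"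
  shows "\<exists>c. (\<forall>i\<in>I. 0 \<le> c i) \<and> (\<forall>q\<in>U. v q = (\<Sum>i\<in>I. c i * a i q))"
  using assms(2,3)
proof (induction I arbitrary: a v rule: finite_induct)
  case empty
  have "(\<Sum>q\<in>U. v q * v q) \<le> 0" by (rule empty) simp
  then have "\<forall>q\<in>U. v q = 0"
    using U sum_nonneg_eq_0_iff[of U "\<lambda>q. v q * v q"] by (simp add: sum_nonneg order_antisym)
  then show ?case by simp
next
  case (insert k I)
  let ?d = "\<lambda>u w. \<Sum>q\<in>U. u q * w q"
  have lin: "?d u (\<lambda>q. w q - r * z q) = ?d u w - r * ?d u z"
    "?d (\<lambda>q. w q - r * z q) u = ?d w u - r * ?d z u" for u w z :: "'a \<Rightarrow> real" and r
    by (simp_all add: sum_subtractf sum_distrib_left algebra_simps)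
  show ?case
  proof (cases "\<forall>w. (\<forall>i\<in>I. ?d (a i) w \<le> 0) \<longrightarrow> ?d v w \<le> 0")
    case True
    then obtain c where "\<forall>i\<in>I. 0 \<le> c i" "\<forall>q\<in>U. v q = (\<Sum>i\<in>I. c i * a i q)"
      using insert.IH[of a v] by blast
    moreover have "(\<Sum>i\<in>I. (if i = k then 0 else c i) * a i q) = (\<Sum>i\<in>I. c i * a i q)" for q
      by (rule sum.cong) (use insert.hyps in auto)
    ultimately show ?thesis using insert.hyps
      by (intro exI[of _ "\<lambda>i. if i = k then 0 else c i"]) auto
  next
    case False
    then obtain y where y: "\<And>i. i \<in> I \<Longrightarrow> ?d (a i) y \<le> 0" "\<not> ?d v y \<le> 0"
      unfolding not_all not_imp by (elim exE conjE) (rule that, erule bspec)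
    have ky: "0 < ?d (a k) y"
    proof (rule ccontr)
      assume "\<not> ?thesis"
      then have "?d (a i) y \<le> 0" if "i \<in> insert k I" for i using y(1)[of i] that by auto
      then have "?d v y \<le> 0" by (rule insert.prems)
      with y(2) show False by simp
    qed
    define z where "z q = y q / ?d (a k) y" for q
    have dz: "?d u z = ?d u y / ?d (a k) y" for u
      unfolding z_def by (simp add: sum_divide_distrib)
    have kz: "?d (a k) z = 1" and iz: "\<And>i. i \<in> I \<Longrightarrow> ?d (a i) z \<le> 0" and vz: "0 < ?d v z"
      using y ky unfolding dz by (auto simp: divide_nonpos_pos)
    have "\<exists>c. (\<forall>i\<in>I. 0 \<le> c i) \<and>
      (\<forall>q\<in>U. v q - ?d v z * a k q = (\<Sum>i\<in>I. c i * (a i q - ?d (a i) z * a k q)))"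
    proof (rule insert.IH)
      fix w
      assume w: "\<And>i. i \<in> I \<Longrightarrow> ?d (\<lambda>q. a i q - ?d (a i) z * a k q) w \<le> 0"
      define x where "x q = w q - ?d (a k) w * z q" for q
      have "?d v x \<le> 0"
      proof (rule insert.prems)
        fix i assume "i \<in> insert k I"
        then show "?d (a i) x \<le> 0"
          using w[of i] kz unfolding x_def lin by (auto simp: mult.commute)
      qed
      then show "?d (\<lambda>q. v q - ?d v z * a k q) w \<le> 0" unfolding x_def lin by (simp add: mult.commute)
    qed
    then obtain c where c: "\<forall>i\<in>I. 0 \<le> c i"
      "\<forall>q\<in>U. v q - ?d v z * a k q = (\<Sum>i\<in>I. c i * (a i q - ?d (a i) z * a k q))"
      by (elim exE conjE) (rule that)
    \<comment> \<open>This collects the multiples of \<open>a k\<close> after undoing the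
      projection; it is nonnegative because each \<open>a i\<close> is nonpositive at
      \<open>z\<close>.\<close>
    define ck where "ck = ?d v z - (\<Sum>i\<in>I. c i * ?d (a i) z)"
    have "(\<Sum>i\<in>I. c i * ?d (a i) z) \<le> 0"
      by (rule sum_nonpos) (use c iz in \<open>auto simp: mult_nonneg_nonpos\<close>)
    then have "0 \<le> ck" using vz by (simp add: ck_def)
    moreover have "v q = ck * a k q + (\<Sum>i\<in>I. c i * a i q)" if "q \<in> U" for q
      using c(2) that unfolding ck_def
      by (simp add: algebra_simps sum_subtractf sum_distrib_left sum_distrib_right)
    moreover have "(\<Sum>i\<in>I. (if i = k then ck else c i) * a i q) = (\<Sum>i\<in>I. c i * a i q)" for q
      by (rule sum.cong) (use insert.hyps in auto)
    ultimately show ?thesis using insert.hyps c(1)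
      by (intro exI[of _ "\<lambda>i. if i = k then ck else c i"]) auto
  qed
qed

section \<open>Cuts, scalings and the polar of the pentagonal cone\<close>

definition cut :: "nat set \<Rightarrow> nat \<times> nat \<Rightarrow> real" where
  "cut S = (\<lambda>(i, j). if (i \<in> S) = (j \<in> S) then 0 else 1)"

text \<open>The exponent of u_x in u_i u_j, that is, the logarithmic direction of a scaling; hence
  the value 2 at (x, x).\<close>

definition star :: "nat \<Rightarrow> nat \<times> nat \<Rightarrow> real" where
  "star x = (\<lambda>(i, j). (if i = x then 1 else 0) + (if j = x then 1 else 0))"

lemma finite_upper_pairs [simp]: "finite (upper_pairs n)"
  by (rule finite_subset[of _ "{..<n} \<times> {..<n}"]) (auto simp: upper_pairs_def)

lemma sum_basis_vec:
  assumes "i < n" "j < n"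
  shows "(\<Sum>q\<in>upper_pairs n. basis_vec i j q * w q) = w (min i j, max i j)"
proof -
  have "(\<Sum>q\<in>upper_pairs n. basis_vec i j q * w q) =
    (\<Sum>q\<in>upper_pairs n. if q = (min i j, max i j) then w q else 0)"
    by (rule sum.cong) (auto simp: basis_vec_def)
  moreover have "(min i j, max i j) \<in> upper_pairs n" using assms by (auto simp: upper_pairs_def)
  ultimately show ?thesis by simp
qed

lemma basis_vec_outside: "i < n \<Longrightarrow> j < n \<Longrightarrow> q \<notin> upper_pairs n \<Longrightarrow> basis_vec i j q = 0"
  by (auto simp: basis_vec_def upper_pairs_def)

lemma sum_pentagonal_ratio:
  fixes w :: "nat \<times> nat \<Rightarrow> real"
  assumes "i < n" "j < n" "k < n" "l < n" "m < n"
  defines "W \<equiv> \<lambda>i j. w (min i j, max i j)"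
  shows "(\<Sum>q\<in>upper_pairs n. pentagonal_ratio i j k l m q * w q) =
    W i j + W i k + W j k + W l l + W l m + W m m
    - W i l - W j l - W k l - W i m - W j m - W k m"
  unfolding pentagonal_ratio_def W_def
  by (simp add: distrib_right left_diff_distrib sum.distrib sum_subtractf sum_basis_vec assms)

lemma upper_pairs_5:
  "upper_pairs 5 = {(0,0),(0,1),(0,2),(0,3),(0,4),(1,1),(1,2),(1,3),(1,4),(2,2),(2,3),(2,4),(3,3),(3,4),(4,4)}"
  (is "_ = ?R")
proof (rule subset_antisym)
  show "upper_pairs 5 \<subseteq> ?R"
  proof
    fix q assume "q \<in> upper_pairs 5"
    then obtain i j where q: "q = (i, j)" "i \<le> j" "j < 5" by (auto simp: upper_pairs_def)
    then have "i = 0 \<or> i = 1 \<or> i = 2 \<or> i = 3 \<or> i = 4" "j = 0 \<or> j = 1 \<or> j = 2 \<or> j = 3 \<or> j = 4"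
      by linarith+
    then show "q \<in> ?R" using q(1,2) by (elim disjE) simp_all
  qed
  show "?R \<subseteq> upper_pairs 5" by (simp add: upper_pairs_def)
qed

text \<open>After normalising \<open>w\<close> to the distance-like function \<open>d\<close>, the hypotheses are the triangle and
  pentagonal inequalities, the facets of the cut cone on five points. The weight \<open>P x y\<close> of the cut
  \<open>{x, y}\<close> is the one forced by the weights \<open>s\<close> of the one-point cuts.\<close>

lemma cut_decomposition:
  fixes w :: "nat \<times> nat \<Rightarrow> real"
  defines "V \<equiv> {..<5::nat}"
  assumes w: "\<forall>i<5. \<forall>j<5. \<forall>k<5. \<forall>l<5. \<forall>m<5.
    (\<Sum>q\<in>upper_pairs 5. pentagonal_ratio i j k l m q * w q) \<le> 0"
  shows "\<exists>s P r. (\<forall>x\<in>V. 0 \<le> s x) \<and> (\<forall>y\<in>V. \<forall>x<y. 0 \<le> P x y) \<and>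
    (\<forall>q\<in>upper_pairs 5. w q = (\<Sum>x\<in>V. s x * cut {x} q) + (\<Sum>y\<in>V. \<Sum>x<y. P x y * cut {x, y} q)
      + (\<Sum>x\<in>V. r x * star x q))"
proof -
  define W where "W i j = w (min i j, max i j)" for i j
  define d where "d i j = W i j - (W i i + W j j) / 2" for i j
  have d: "d i j = d j i" "d i i = 0" for i j
    by (auto simp: d_def W_def min.commute max.commute)
  have card: "card V = 5" by (simp add: V_def)
  \<comment> \<open>In the pentagonal ratio of e, f, e | a, e all terms cancel except e_ef + e_aa -
    e_ae - e_af.\<close>
  have triangle: "d e f \<le> d a e + d a f" if "a \<in> V" "e \<in> V" "f \<in> V" for a e f
    using w[rule_format, of e f e a e] that sum_pentagonal_ratio[of e 5 f e a e w, folded W_def]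
    by (simp add: V_def d_def W_def min.commute max.commute field_simps)
  have pentagon: "d i j + d i k + d j k + d l m \<le> d i l + d j l + d k l + d i m + d j m + d k m"
    if "i \<in> V" "j \<in> V" "k \<in> V" "l \<in> V" "m \<in> V" for i j k l m
    using w[rule_format, of i j k l m] that sum_pentagonal_ratio[of i 5 j k l m w, folded W_def]
    by (simp add: V_def d_def field_simps)
  \<comment> \<open>With p x the sum of P x y over y \<noteq> x, the desired expansion reads d a b =
    s a + s b + p a + p b - 2 P a b. Summing over b, and then over a as well, expresses p through
    \<open>D\<close> and \<open>s\<close>; solving for P a b gives
    \<open>c a b + sum s V / 3 - s a - s b\<close>, which is the origin of 1/2 and 1/6.\<close>
  define D where "D x = sum (d x) V" for x
  define c where "c x y = (D x + D y - d x y) / 2 - sum D V / 6" for x y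
  have Dx: "D x = d x a + d x b + d x e + d x f + d x g"
    if "V = {a, b, e, f, g}" "distinct [a, b, e, f, g]" for x a b e f g
    using that by (simp add: D_def)
  have Ds: "sum D V = D a + D b + D e + D f + D g"
    if "V = {a, b, e, f, g}" "distinct [a, b, e, f, g]" for a b e f g
    using that by simp
  have "\<exists>s. (\<forall>x\<in>V. 0 \<le> s x) \<and>
    (\<forall>x\<in>V. \<forall>y\<in>V. x \<noteq> y \<longrightarrow> s x + s y \<le> c x y + sum s V / 3)"
  proof (rule five_vertex_packing[OF card])
    show "c x y = c y x" for x y using d(1)[of x y] by (simp add: c_def)
  next
    fix a b e f g assume sub: "{a, b, e, f, g} \<subseteq> V" and dist: "distinct [a, b, e, f, g]"
    have "{a, b, e, f, g} = V"
      by (rule card_subset_eq) (use sub dist card in \<open>simp_all add: V_def\<close>)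
    then have V: "V = {a, b, e, f, g}" by simp
    have Dab: "D a = d a b + d a e + d a f + d a g" "D b = d a b + d b e + d b f + d b g"
      "D e = d a e + d b e + d e f + d e g" "D f = d a f + d b f + d e f + d f g"
      "D g = d a g + d b g + d e g + d f g"
      unfolding Dx[OF V dist] using d(1)[of b a] d(1)[of e a] d(1)[of f a] d(1)[of g a] d(1)[of e b]
        d(1)[of f b] d(1)[of g b] d(1)[of f e] d(1)[of g e] d(1)[of g f] d(2)
      by simp_all
    have "c a b + c a e + c f g = (d a f + d a g - d f g) / 2"
      unfolding c_def Ds[OF V dist] Dab by (simp add: field_simps)
    then show "0 \<le> c a b + c a e + c f g" using triangle[of a f g] V by simp
    have "3 * c a b + c e f + c e g + c f g = (d a e + d a f + d a g + d b e + d b f + d b g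
      - d a b - d e f - d e g - d f g) / 2"
      unfolding c_def Ds[OF V dist] Dab by (simp add: field_simps)
    then show "0 \<le> 3 * c a b + c e f + c e g + c f g"
      using pentagon[of e f g a b] V d(1)[of e a] d(1)[of f a] d(1)[of g a] d(1)[of e b]
        d(1)[of f b] d(1)[of g b] by simp
  qed
  then obtain s where s: "\<forall>x\<in>V. 0 \<le> s x"
    "\<forall>x\<in>V. \<forall>y\<in>V. x \<noteq> y \<longrightarrow> s x + s y \<le> c x y + sum s V / 3"
    by (elim exE conjE) (rule that)
  define P where "P x y = c x y + sum s V / 3 - s x - s y" for x y
  have P: "\<forall>y\<in>V. \<forall>x<y. 0 \<le> P x y"
  proof (intro ballI allI impI)
    fix y x assume "y \<in> V" "x < y"
    then have "s x + s y \<le> c x y + sum s V / 3" using s(2) by (auto simp: V_def)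
    then show "0 \<le> P x y" by (simp add: P_def)
  qed
  have V5: "V = {0, 1, 2, 3, 4}" unfolding V_def by (auto simp: numeral_eq_Suc less_Suc_eq)
  have lt: "{..<1::nat} = {0}" "{..<2::nat} = {0,1}" "{..<3::nat} = {0,1,2}" "{..<4::nat} = {0,1,2,3}"
    by (auto simp: numeral_eq_Suc less_Suc_eq)
  have Psym: "P x y = P y x" for x y
    using d(1)[of x y] by (simp add: P_def c_def)
  have pair: "d a b = s a + s b + (P a e + P b e) + (P a f + P b f) + (P a g + P b g)"
    if lt: "a < 5" "b < 5" "e < 5" "f < 5" "g < 5" and dist: "distinct [a, b, e, f, g]" for a b e f g
  proof -
    have "{a, b, e, f, g} = V"
      by (rule card_subset_eq) (use lt dist in \<open>auto simp: V_def\<close>)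
    then have V: "V = {a, b, e, f, g}" by simp
    have "sum s V = s a + s b + s e + s f + s g" using V dist by simp
    moreover have "D a = d a b + d a e + d a f + d a g" "D b = d a b + d b e + d b f + d b g"
      using Dx[OF V dist, of a] Dx[OF V dist, of b] d(1)[of b a] d(2) by simp_all
    moreover note Ds[OF V dist]
    ultimately show ?thesis unfolding P_def c_def by (simp add: field_simps)
  qed
  have wd: "w (x, y) = d x y + (W x x + W y y) / 2" if "x \<le> y" for x y
    using that by (simp add: d_def W_def)
  note pairs =
    pair[of 0 1 2 3 4] pair[of 0 2 1 3 4] pair[of 0 3 1 2 4] pair[of 0 4 1 2 3] pair[of 1 2 0 3 4]
    pair[of 1 3 0 2 4] pair[of 1 4 0 2 3] pair[of 2 3 0 1 4] pair[of 2 4 0 1 3] pair[of 3 4 0 1 2]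
  note Psym10 =
    Psym[of 1 0] Psym[of 2 0] Psym[of 3 0] Psym[of 4 0] Psym[of 2 1] Psym[of 3 1] Psym[of 4 1]
    Psym[of 3 2] Psym[of 4 2] Psym[of 4 3]
  have wq: "\<forall>q\<in>upper_pairs 5. w q = (\<Sum>x\<in>V. s x * cut {x} q)
    + (\<Sum>y\<in>V. \<Sum>x<y. P x y * cut {x, y} q) + (\<Sum>x\<in>V. W x x / 2 * star x q)"
    unfolding upper_pairs_5 V5
    by (intro ballI; elim insertE emptyE; simp add: lt cut_def star_def wd d(2) del: One_nat_def;
        (insert pairs Psym10, simp del: One_nat_def)?)
  show ?thesis
    by (intro exI[of _ s] exI[of _ P] exI[of _ "\<lambda>x. W x x / 2"] conjI s(1) P wq)
qed

lemma sum_mult_sum_swap: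
  fixes \<alpha> :: "'a \<Rightarrow> real"
  shows "(\<Sum>q\<in>U. \<alpha> q * (\<Sum>x\<in>X. f x * g x q)) = (\<Sum>x\<in>X. f x * (\<Sum>q\<in>U. \<alpha> q * g x q))"
  unfolding sum_distrib_left by (subst sum.swap) (simp add: mult.left_commute)

text \<open>A test vector of the Farkas lemma splits by \<open>cut_decomposition\<close>. Its cut
  weights are nonnegative, so an inequality on cuts is enough; its star weights have no sign, which
  is why \<open>star\<close> is an equation.\<close>

lemma pentagonal_cone_5:
  fixes \<alpha> :: "nat \<times> nat \<Rightarrow> real"
  assumes out: "\<And>q. q \<notin> upper_pairs 5 \<Longrightarrow> \<alpha> q = 0"
    and star: "\<And>x. x < 5 \<Longrightarrow> (\<Sum>q\<in>upper_pairs 5. \<alpha> q * star x q) = 0"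
    and cut: "\<And>S. (\<Sum>q\<in>upper_pairs 5. \<alpha> q * cut S q) \<le> 0"
  shows "\<alpha> \<in> nonneg_cone {pentagonal_ratio i j k l m | i j k l m. i < 5 \<and> j < 5 \<and> k < 5 \<and> l < 5 \<and> m < 5}"
    (is "_ \<in> nonneg_cone ?S")
proof -
  let ?U = "upper_pairs 5"
  have fin: "finite ?S"
  proof (rule finite_subset)
    show "?S \<subseteq> (\<lambda>(i, j, k, l, m). pentagonal_ratio i j k l m) `
      ({..<5} \<times> {..<5} \<times> {..<5} \<times> {..<5} \<times> {..<5})"
    proof
      fix s assume "s \<in> ?S"
      then obtain i j k l m where "s = pentagonal_ratio i j k l m" "i < 5" "j < 5" "k < 5" "l < 5" "m < 5"
        by blast
      then show "s \<in> (\<lambda>(i, j, k, l, m). pentagonal_ratio i j k l m) `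
        ({..<5} \<times> {..<5} \<times> {..<5} \<times> {..<5} \<times> {..<5})"
        by (intro image_eqI[of _ _ "(i, j, k, l, m)"]) simp_all
    qed
  qed simp
  have "\<exists>c. (\<forall>s\<in>?S. 0 \<le> c s) \<and> (\<forall>q\<in>?U. \<alpha> q = (\<Sum>s\<in>?S. c s * s q))"
  proof (rule farkas[OF finite_upper_pairs fin])
    fix w :: "nat \<times> nat \<Rightarrow> real"
    assume w: "\<And>s. s \<in> ?S \<Longrightarrow> (\<Sum>q\<in>?U. s q * w q) \<le> 0"
    have pent: "\<forall>i<5. \<forall>j<5. \<forall>k<5. \<forall>l<5. \<forall>m<5.
      (\<Sum>q\<in>?U. pentagonal_ratio i j k l m q * w q) \<le> 0"
      by (intro allI impI w) blast
    obtain s P r where s: "\<forall>x\<in>{..<5}. 0 \<le> s x" and P: "\<forall>y\<in>{..<5}. \<forall>x<y. 0 \<le> P x y" and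
      dec: "\<forall>q\<in>?U. w q = (\<Sum>x\<in>{..<5}. s x * cut {x} q) + (\<Sum>y\<in>{..<5}. \<Sum>x<y. P x y * cut {x, y} q)
        + (\<Sum>x\<in>{..<5}. r x * star x q)"
      using cut_decomposition[OF pent] by (elim exE conjE) (rule that)
    \<comment> \<open>The factor \<open>1 *\<close> gives the outer sum the shape required by
      \<open>sum_mult_sum_swap\<close>.\<close>
    have "(\<Sum>q\<in>?U. \<alpha> q * w q) = (\<Sum>q\<in>?U. \<alpha> q * (\<Sum>x<5. s x * cut {x} q)
      + \<alpha> q * (\<Sum>y<5. 1 * (\<Sum>x<y. P x y * cut {x, y} q)) + \<alpha> q * (\<Sum>x<5. r x * star x q))"
      using dec by (intro sum.cong refl) (simp add: distrib_left)
    also have "\<dots> = (\<Sum>x<5. s x * (\<Sum>q\<in>?U. \<alpha> q * cut {x} q))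
      + (\<Sum>y<5. 1 * (\<Sum>x<y. P x y * (\<Sum>q\<in>?U. \<alpha> q * cut {x, y} q))) + (\<Sum>x<5. r x * (\<Sum>q\<in>?U. \<alpha> q * star x q))"
    proof -
      have "(\<Sum>q\<in>?U. \<alpha> q * (\<Sum>y<5. 1 * (\<Sum>x<y. P x y * cut {x, y} q)))
        = (\<Sum>y<5. 1 * (\<Sum>q\<in>?U. \<alpha> q * (\<Sum>x<y. P x y * cut {x, y} q)))"
        by (rule sum_mult_sum_swap)
      also have "\<dots> = (\<Sum>y<5. 1 * (\<Sum>x<y. P x y * (\<Sum>q\<in>?U. \<alpha> q * cut {x, y} q)))"
        by (intro sum.cong refl arg_cong2[of _ _ _ _ "(*)"] sum_mult_sum_swap)
      finally have pairs: "(\<Sum>q\<in>?U. \<alpha> q * (\<Sum>y<5. 1 * (\<Sum>x<y. P x y * cut {x, y} q))) = \<dots>" .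
      show ?thesis
        unfolding sum.distrib pairs by (intro arg_cong2[of _ _ _ _ "(+)"] refl sum_mult_sum_swap)
    qed
    also have "\<dots> \<le> 0 + 0 + 0"
    proof (intro add_mono)
      show "(\<Sum>x<5. s x * (\<Sum>q\<in>?U. \<alpha> q * cut {x} q)) \<le> 0"
        by (rule sum_nonpos, rule mult_nonneg_nonpos) (use s cut in blast)+
      show "(\<Sum>y<5. 1 * (\<Sum>x<y. P x y * (\<Sum>q\<in>?U. \<alpha> q * cut {x, y} q))) \<le> 0"
        unfolding mult_1
        by (rule sum_nonpos, rule sum_nonpos, rule mult_nonneg_nonpos) (use P cut in \<open>blast, blast\<close>)
      show "(\<Sum>x<5. r x * (\<Sum>q\<in>?U. \<alpha> q * star x q)) \<le> 0"
        using star by simp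
    qed
    finally show "(\<Sum>q\<in>?U. \<alpha> q * w q) \<le> 0" by simp
  qed
  then obtain c where c: "\<forall>s\<in>?S. 0 \<le> c s" "\<forall>q\<in>?U. \<alpha> q = (\<Sum>s\<in>?S. c s * s q)"
    by (elim exE conjE) (rule that)
  have "s q = 0" if "s \<in> ?S" "q \<notin> ?U" for s q
    using that by (auto simp: pentagonal_ratio_def basis_vec_outside)
  then have sum0: "(\<Sum>s\<in>?S. c s * s q) = 0" if "q \<notin> ?U" for q
    using that by (intro sum.neutral) simp
  have "\<alpha> = (\<lambda>q. \<Sum>s\<in>?S. c s * s q)"
  proof
    fix q
    show "\<alpha> q = (\<Sum>s\<in>?S. c s * s q)"
    proof (cases "q \<in> ?U")
      case True
      then show ?thesis by (rule c(2)[rule_format])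
    next
      case False
      then show ?thesis unfolding sum0[OF False] by (rule out)
    qed
  qed
  then show ?thesis using fin c(1) unfolding nonneg_cone_def
    by (intro CollectI exI[of _ ?S] exI[of _ c] conjI subset_refl)
qed

section \<open>Lorentzian matrices\<close>

lemma lorentzian_mats_symmetric:
  assumes "A \<in> lorentzian_mats n" "i < n" "j < n"
  shows "A $$ (i, j) = A $$ (j, i)"
proof -
  have "A \<in> carrier_mat n n" "A\<^sup>T = A" using assms(1) by (auto simp: lorentzian_mats_def)
  then show ?thesis using assms(2,3) by (metis carrier_matD index_transpose_mat(1))
qed

lemma lorentzian_mats_hyperplane:
  "A \<in> lorentzian_mats n \<longleftrightarrow> A \<in> carrier_mat n n \<and> A\<^sup>T = A \<and> (\<forall>i<n. \<forall>j<n. 0 \<le> A $$ (i, j)) \<and>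
    (\<exists>h. \<forall>x. (\<Sum>i<n. h i * x i) = 0 \<longrightarrow> quad_form n A x \<le> 0)"
proof (cases "A \<in> carrier_mat n n \<and> A\<^sup>T = A")
  case True
  then show ?thesis unfolding lorentzian_mats_def using one_positive_eigenvalue_iff[of A n] by simp
next
  case False
  then show ?thesis by (auto simp: lorentzian_mats_def)
qed

lemma sum_mult_point_masses:
  fixes f :: "nat \<Rightarrow> real"
  assumes "i < n" "j < n" "k < n" "l < n" "m < n"
  shows "(\<Sum>a<n. f a * ((if a = i then x1 else 0) + (if a = j then x2 else 0) + (if a = k then x3 else 0)
      + (if a = l then x4 else 0) + (if a = m then x5 else 0)))
    = f i * x1 + f j * x2 + f k * x3 + f l * x4 + f m * x5"
proof -
  have "(\<Sum>a<n. f a * (if a = b then x else 0)) = f b * x" if "b < n" for b and x :: real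
  proof -
    have "(\<Sum>a<n. f a * (if a = b then x else 0)) = (\<Sum>a<n. if a = b then f a * x else 0)"
      by (rule sum.cong) auto
    then show ?thesis using that by simp
  qed
  then show ?thesis using assms by (simp only: distrib_left sum.distrib)
qed

text \<open>The five coordinates become point masses at i, j, k, l, m. Masses at equal indices add
  up, so the indices may coincide and \<open>h\<close> pulls back to five numbers. The diagonal
  terms of i, j, k that \<open>form5\<close> omits are nonnegative.\<close>

lemma lorentzian_form5_nonpos:
  assumes A: "A \<in> lorentzian_mats n" and lt: "i < n" "j < n" "k < n" "l < n" "m < n"
  shows "\<exists>h1 h2 h3 h4 h5. \<forall>x1 x2 x3 x4 x5. h1 * x1 + h2 * x2 + h3 * x3 + h4 * x4 + h5 * x5 = 0 \<longrightarrow>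
    form5 (A $$ (i, j)) (A $$ (i, k)) (A $$ (j, k)) (A $$ (i, l)) (A $$ (j, l)) (A $$ (k, l))
      (A $$ (i, m)) (A $$ (j, m)) (A $$ (k, m)) (A $$ (l, l)) (A $$ (m, m)) (A $$ (l, m))
      x1 x2 x3 x4 x5 x1 x2 x3 x4 x5 \<le> 0"
proof -
  from A have "\<exists>h. \<forall>x. (\<Sum>i<n. h i * x i) = 0 \<longrightarrow> quad_form n A x \<le> 0"
    unfolding lorentzian_mats_hyperplane by (elim conjE)
  then obtain h where "\<forall>x. (\<Sum>i<n. h i * x i) = 0 \<longrightarrow> quad_form n A x \<le> 0" ..
  then have h: "quad_form n A x \<le> 0" if "(\<Sum>i<n. h i * x i) = 0" for x
    using that by simp
  have nonneg: "0 \<le> A $$ (a, a)" if "a < n" for a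
    using A that by (auto simp: lorentzian_mats_def)
  note sym = lorentzian_mats_symmetric[OF A]
  have "form5 (A $$ (i, j)) (A $$ (i, k)) (A $$ (j, k)) (A $$ (i, l)) (A $$ (j, l)) (A $$ (k, l))
      (A $$ (i, m)) (A $$ (j, m)) (A $$ (k, m)) (A $$ (l, l)) (A $$ (m, m)) (A $$ (l, m))
      x1 x2 x3 x4 x5 x1 x2 x3 x4 x5 \<le> 0"
    if hx: "h i * x1 + h j * x2 + h k * x3 + h l * x4 + h m * x5 = 0" for x1 x2 x3 x4 x5
  proof -
    define x where "x a = (if a = i then x1 else 0) + (if a = j then x2 else 0) + (if a = k then x3 else 0)
      + (if a = l then x4 else 0) + (if a = m then x5 else 0)" for a
    have pm: "(\<Sum>a<n. f a * x a) = f i * x1 + f j * x2 + f k * x3 + f l * x4 + f m * x5" for f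
      unfolding x_def by (rule sum_mult_point_masses[OF lt])
    have "quad_form n A x = (\<Sum>a<n. (\<Sum>b<n. A $$ (a, b) * x b) * x a)"
      unfolding quad_form_def sum_distrib_right by (intro sum.cong refl) (simp add: mult_ac)
    also have "\<dots> = form5 (A $$ (i, j)) (A $$ (i, k)) (A $$ (j, k)) (A $$ (i, l)) (A $$ (j, l)) (A $$ (k, l))
      (A $$ (i, m)) (A $$ (j, m)) (A $$ (k, m)) (A $$ (l, l)) (A $$ (m, m)) (A $$ (l, m))
      x1 x2 x3 x4 x5 x1 x2 x3 x4 x5 + A $$ (i, i) * x1\<^sup>2 + A $$ (j, j) * x2\<^sup>2 + A $$ (k, k) * x3\<^sup>2"
      unfolding pm form5_def using sym[OF lt(2) lt(1)] sym[OF lt(3) lt(1)] sym[OF lt(4) lt(1)]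
        sym[OF lt(5) lt(1)] sym[OF lt(3) lt(2)] sym[OF lt(4) lt(2)] sym[OF lt(5) lt(2)]
        sym[OF lt(4) lt(3)] sym[OF lt(5) lt(3)] sym[OF lt(5) lt(4)]
      by (simp add: power2_eq_square algebra_simps)
    finally have "quad_form n A x = \<dots>" .
    moreover have "quad_form n A x \<le> 0" by (rule h) (simp add: pm hx)
    moreover have "0 \<le> A $$ (i, i) * x1\<^sup>2 + A $$ (j, j) * x2\<^sup>2 + A $$ (k, k) * x3\<^sup>2"
      using nonneg lt by simp
    ultimately show ?thesis by linarith
  qed
  then show ?thesis
    by (intro exI[of _ "h i"] exI[of _ "h j"] exI[of _ "h k"] exI[of _ "h l"] exI[of _ "h m"] allI impI)
qed

lemma form5_reverse_cauchy_schwarz: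
  fixes r s t p1 p2 p3 q1 q2 q3 a b c :: real
  defines "F \<equiv> form5 r s t p1 p2 p3 q1 q2 q3 a b c"
  assumes neg: "\<And>x1 x2 x3 x4 x5. h1 * x1 + h2 * x2 + h3 * x3 + h4 * x4 + h5 * x5 = 0 \<Longrightarrow>
      F x1 x2 x3 x4 x5 x1 x2 x3 x4 x5 \<le> 0"
    and pos: "0 < F x1 x2 x3 x4 x5 x1 x2 x3 x4 x5"
  shows "F x1 x2 x3 x4 x5 x1 x2 x3 x4 x5 * F y1 y2 y3 y4 y5 y1 y2 y3 y4 y5
        \<le> (F x1 x2 x3 x4 x5 y1 y2 y3 y4 y5)\<^sup>2"
proof -
  have sym: "F x1 x2 x3 x4 x5 y1 y2 y3 y4 y5 = F y1 y2 y3 y4 y5 x1 x2 x3 x4 x5"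
    for x1 x2 x3 x4 x5 y1 y2 y3 y4 y5
    unfolding F_def form5_def by (simp add: mult.commute add.commute)
  have lin1: "F (y1 + u * x1) (y2 + u * x2) (y3 + u * x3) (y4 + u * x4) (y5 + u * x5) z1 z2 z3 z4 z5
    = F y1 y2 y3 y4 y5 z1 z2 z3 z4 z5 + u * F x1 x2 x3 x4 x5 z1 z2 z3 z4 z5"
    for x1 x2 x3 x4 x5 y1 y2 y3 y4 y5 z1 z2 z3 z4 z5 u
    unfolding F_def form5_def by (simp add: algebra_simps)
  have lin2: "F z1 z2 z3 z4 z5 (y1 + u * x1) (y2 + u * x2) (y3 + u * x3) (y4 + u * x4) (y5 + u * x5)
    = F z1 z2 z3 z4 z5 y1 y2 y3 y4 y5 + u * F z1 z2 z3 z4 z5 x1 x2 x3 x4 x5"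
    for x1 x2 x3 x4 x5 y1 y2 y3 y4 y5 z1 z2 z3 z4 z5 u
    using lin1[of y1 u x1 y2 x2 y3 x3 y4 x4 y5 x5 z1 z2 z3 z4 z5]
    by (simp only: sym[of z1 z2 z3 z4 z5])
  note lin = lin1 lin2
  define hx hy where "hx = h1 * x1 + h2 * x2 + h3 * x3 + h4 * x4 + h5 * x5"
    and "hy = h1 * y1 + h2 * y2 + h3 * y3 + h4 * y4 + h5 * y5"
  define Fx Fy Fxy where "Fx = F x1 x2 x3 x4 x5 x1 x2 x3 x4 x5" and "Fy = F y1 y2 y3 y4 y5 y1 y2 y3 y4 y5"
    and "Fxy = F x1 x2 x3 x4 x5 y1 y2 y3 y4 y5"
  have "hx \<noteq> 0" using neg[of x1 x2 x3 x4 x5] pos by (auto simp: hx_def)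
  \<comment> \<open>This moves \<open>y\<close> along \<open>x\<close> into the hyperplane.
    Multiplying the resulting inequality by the positive value at \<open>x\<close> completes the
    square.\<close>
  define u where "u = - hy / hx"
  have "h1 * (y1 + u * x1) + h2 * (y2 + u * x2) + h3 * (y3 + u * x3) + h4 * (y4 + u * x4)
    + h5 * (y5 + u * x5) = hy + u * hx" by (simp add: hx_def hy_def algebra_simps)
  also have "\<dots> = 0" using \<open>hx \<noteq> 0\<close> by (simp add: u_def)
  finally have "F (y1 + u * x1) (y2 + u * x2) (y3 + u * x3) (y4 + u * x4) (y5 + u * x5)
    (y1 + u * x1) (y2 + u * x2) (y3 + u * x3) (y4 + u * x4) (y5 + u * x5) \<le> 0" by (rule neg)
  also have "F (y1 + u * x1) (y2 + u * x2) (y3 + u * x3) (y4 + u * x4) (y5 + u * x5)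
    (y1 + u * x1) (y2 + u * x2) (y3 + u * x3) (y4 + u * x4) (y5 + u * x5) = Fy + 2 * u * Fxy + u\<^sup>2 * Fx"
    unfolding lin sym[of y1 y2 y3 y4 y5 x1 x2 x3 x4 x5] Fx_def Fy_def Fxy_def
    by (simp add: power2_eq_square algebra_simps)
  finally have "Fx * (Fy + 2 * u * Fxy + u\<^sup>2 * Fx) \<le> 0"
    using pos by (simp add: Fx_def mult_le_0_iff)
  moreover have "Fx * (Fy + 2 * u * Fxy + u\<^sup>2 * Fx) = Fx * Fy - Fxy\<^sup>2 + (Fxy + u * Fx)\<^sup>2"
    by (simp add: power2_eq_square algebra_simps)
  ultimately have "Fx * Fy \<le> Fxy\<^sup>2" using zero_le_power2[of "Fxy + u * Fx"] by linarith
  then show ?thesis by (simp add: Fx_def Fy_def Fxy_def)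
qed

lemma pentagonal_inequality:
  assumes A: "p \<in> lorentzian_mats n" and lt: "i < n" "j < n" "k < n" "l < n" "m < n"
  shows "p $$ (i, j) * p $$ (i, k) * p $$ (j, k) * p $$ (l, l) * p $$ (l, m) * p $$ (m, m)
    \<le> 4 * (p $$ (i, l) * p $$ (j, l) * p $$ (k, l) * p $$ (i, m) * p $$ (j, m) * p $$ (k, m))"
proof -
  have nonneg: "0 \<le> p $$ (a, b)" if "a < n" "b < n" for a b
    using A that by (auto simp: lorentzian_mats_def)
  note [simp] = nonneg lt
  show ?thesis
  proof (cases "p $$ (i, j) = 0 \<or> p $$ (i, k) = 0 \<or> p $$ (j, k) = 0 \<or> p $$ (l, l) = 0 \<or> p $$ (l, m) = 0
    \<or> p $$ (m, m) = 0")
    case True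
    then have "p $$ (i, j) * p $$ (i, k) * p $$ (j, k) * p $$ (l, l) * p $$ (l, m) * p $$ (m, m) = 0" by auto
    moreover have "0 \<le> 4 * (p $$ (i, l) * p $$ (j, l) * p $$ (k, l) * p $$ (i, m) * p $$ (j, m) * p $$ (k, m))"
      by simp
    ultimately show ?thesis by linarith
  next
    case False
    have pos: "0 < p $$ (a, b)" if "a < n" "b < n" "p $$ (a, b) \<noteq> 0" for a b
      using nonneg[OF that(1,2)] that(3) by simp
    from False have pos: "0 < p $$ (i, j)" "0 < p $$ (i, k)" "0 < p $$ (j, k)" "0 < p $$ (l, l)" "0 < p $$ (m, m)"
      "0 < p $$ (l, m)"
      by (auto intro!: pos)
    obtain h1 h2 h3 h4 h5 where h: "\<forall>x1 x2 x3 x4 x5. h1 * x1 + h2 * x2 + h3 * x3 + h4 * x4 + h5 * x5 = 0 \<longrightarrow>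
      form5 (p $$ (i, j)) (p $$ (i, k)) (p $$ (j, k)) (p $$ (i, l)) (p $$ (j, l)) (p $$ (k, l))
      (p $$ (i, m)) (p $$ (j, m)) (p $$ (k, m)) (p $$ (l, l)) (p $$ (m, m)) (p $$ (l, m))
      x1 x2 x3 x4 x5 x1 x2 x3 x4 x5 \<le> 0"
      using lorentzian_form5_nonpos[OF A lt] by (elim exE) (rule that)
    show ?thesis
      by (rule form5_pentagonal[OF pos]) (simp_all add: form5_reverse_cauchy_schwarz[OF h[rule_format]])
  qed
qed

section \<open>Gram matrices of Lorentzian vectors and sharpness of the constant\<close>

text \<open>A Gram matrix for the form 2XY - 2Z^2 of signature (1, 2): where the functional
  \<open>X\<close> vanishes, only the negative square of \<open>Z\<close> is left. The extremal
  family, the rank one matrices and the cut matrices are all of this kind.\<close>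

lemma lorentzian_gram:
  fixes X Y Z :: "nat \<Rightarrow> real"
  assumes nonneg: "\<And>a b. a < n \<Longrightarrow> b < n \<Longrightarrow> 0 \<le> X a * Y b + X b * Y a - 2 * Z a * Z b"
  shows "mat n n (\<lambda>(a, b). X a * Y b + X b * Y a - 2 * Z a * Z b) \<in> lorentzian_mats n"
    (is "?P \<in> _")
proof -
  have "quad_form n ?P x \<le> 0" if X: "(\<Sum>a<n. X a * x a) = 0" for x
  proof -
    have "quad_form n ?P x = (\<Sum>a<n. \<Sum>b<n. (X a * x a) * (Y b * x b) + (Y a * x a) * (X b * x b)
      - 2 * ((Z a * x a) * (Z b * x b)))"
      unfolding quad_form_def by (intro sum.cong refl) (simp add: algebra_simps)
    also have "\<dots> = (\<Sum>a<n. X a * x a) * (\<Sum>b<n. Y b * x b) + (\<Sum>a<n. Y a * x a) * (\<Sum>b<n. X b * x b)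
      - 2 * ((\<Sum>a<n. Z a * x a) * (\<Sum>b<n. Z b * x b))"
      unfolding sum_product by (simp add: sum.distrib sum_subtractf sum_distrib_left)
    finally show ?thesis unfolding X by simp
  qed
  then show ?thesis unfolding lorentzian_mats_hyperplane using nonneg
    by (auto intro!: eq_matI exI[of _ X])
qed

text \<open>As t tends to 0, the vectors of \<open>l\<close> and \<open>m\<close> tend to the
  isotropic vectors of \<open>i\<close> and \<open>k\<close>, and the quotient of the two sides is 4
  (1 + t^2) / (1 + t)^2. All other indices carry the zero vector, so one family serves every
  n.\<close>

lemma pentagonal_constant_optimal:
  assumes lt: "i < n" "j < n" "k < n" "l < n" "m < n" and dist: "distinct [i, j, k, l, m]"
    and c: "\<And>p. p \<in> lorentzian_mats n \<Longrightarrow>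
      p $$ (i, j) * p $$ (i, k) * p $$ (j, k) * p $$ (l, l) * p $$ (l, m) * p $$ (m, m)
      \<le> c * (p $$ (i, l) * p $$ (j, l) * p $$ (k, l) * p $$ (i, m) * p $$ (j, m) * p $$ (k, m))"
  shows "4 \<le> c"
proof -
  have key: "4 * (1 + t\<^sup>2) \<le> c * (1 + t)\<^sup>2" if t: "0 < t" for t
  proof -
    \<comment> \<open>The isotropic vectors \<open>(X, Z, Y) = (x\<^sup>2, x y, y\<^sup>2)\<close> of i, j, k come from the points 0, 1, infinity of
      the projective line; Hadamard's inequality is sharp for them in the limit \<open>t \<rightarrow> 0\<close>.\<close>
    define X where "X = (\<lambda>_. 0 :: real)(j := 1, k := 1, l := t, m := 1)"
    define Y where "Y = (\<lambda>_. 0 :: real)(i := 1, j := 1, l := 1, m := t)"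
    define Z where "Z = (\<lambda>_. 0 :: real)(j := 1)"
    define P where "P = mat n n (\<lambda>(a, b). X a * Y b + X b * Y a - 2 * Z a * Z b)"
    have XY: "0 \<le> X a" "0 \<le> Y a" for a using t by (auto simp: X_def Y_def)
    have "P \<in> lorentzian_mats n" unfolding P_def
    proof (rule lorentzian_gram)
      fix a b
      show "0 \<le> X a * Y b + X b * Y a - 2 * Z a * Z b"
      proof (cases "a = j \<and> b = j")
        case True
        then show ?thesis using dist by (auto simp: X_def Y_def Z_def)
      next
        case False
        then have "Z a * Z b = 0" by (auto simp: Z_def)
        then have "2 * Z a * Z b = 0" by simp
        moreover have "0 \<le> X a * Y b + X b * Y a" using XY by simp
        ultimately show ?thesis by linarith
      qed
    qed
    moreover have "P $$ (i, j) = 1" "P $$ (i, k) = 1" "P $$ (j, k) = 1" "P $$ (l, l) = 2 * t"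
      "P $$ (l, m) = 1 + t\<^sup>2" "P $$ (m, m) = 2 * t" "P $$ (i, l) = t" "P $$ (j, l) = 1 + t"
      "P $$ (k, l) = 1" "P $$ (i, m) = 1" "P $$ (j, m) = 1 + t" "P $$ (k, m) = t"
      using lt dist by (auto simp: P_def X_def Y_def Z_def power2_eq_square)
    ultimately have "2 * t * (1 + t\<^sup>2) * (2 * t) \<le> c * (t * (1 + t) * (1 + t) * t)"
      using c[of P] by simp
    then have "t\<^sup>2 * (4 * (1 + t\<^sup>2)) \<le> t\<^sup>2 * (c * (1 + t)\<^sup>2)" by (simp add: power2_eq_square mult_ac)
    then show ?thesis using t by simp
  qed
  show ?thesis
  proof (rule ccontr)
    assume "\<not> 4 \<le> c"
    then have c4: "c < 4" by simp
    have c0: "0 < c" using key[of 1] by simp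
    \<comment> \<open>For 0 < c < 4 and t \<le> 1, c (1 + t)^2 is at most c + 12 t, and this t makes
      that bound the midpoint of c and 4.\<close>
    define t where "t = (4 - c) / 24"
    have t: "0 < t" "t < 1" using c4 c0 by (auto simp: t_def)
    have "t\<^sup>2 \<le> t" using t by (simp add: power2_eq_square mult_le_one)
    then have "(1 + t)\<^sup>2 \<le> 1 + 3 * t" by (simp add: power2_eq_square algebra_simps)
    then have "c * (1 + t)\<^sup>2 \<le> c * (1 + 3 * t)" using c0 by (intro mult_left_mono) auto
    also have "\<dots> \<le> c + 12 * t" using c4 t by (simp add: algebra_simps)
    also have "\<dots> < 4" using c4 by (simp add: t_def field_simps)
    finally have "c * (1 + t)\<^sup>2 < 4" .
    moreover have "4 \<le> 4 * (1 + t\<^sup>2)" by simp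
    ultimately show False using key[OF t(1)] by linarith
  qed
qed

section \<open>Bounded ratios\<close>

lemma prod_powr_eq_exp:
  assumes "finite U" "\<And>q. q \<in> U \<Longrightarrow> (0 :: real) < f q"
  shows "(\<Prod>q\<in>U. f q powr \<alpha> q) = exp (\<Sum>q\<in>U. \<alpha> q * ln (f q))"
  unfolding exp_sum[OF assms(1)] using assms(2) by (intro prod.cong) (force simp: powr_def)+

text \<open>Along the curve the ratio is t raised to the sum in question, and a positive power of t
  is unbounded; the contradiction comes from the t at which it equals c + 1.\<close>

lemma bounded_ratio_monomial_curve:
  assumes \<alpha>: "\<alpha> \<in> bounded_ratios n X"
    and curve: "\<And>t. 1 \<le> t \<Longrightarrow> \<exists>A\<in>X. \<forall>q\<in>upper_pairs n. A $$ q = t powr w q"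
  shows "(\<Sum>q\<in>upper_pairs n. \<alpha> q * w q) \<le> 0"
proof (rule ccontr)
  define s where "s = (\<Sum>q\<in>upper_pairs n. \<alpha> q * w q)"
  assume "\<not> ?thesis"
  then have s: "0 < s" by (simp add: s_def)
  obtain c where c: "0 < c" "\<And>A. A \<in> X \<Longrightarrow> (\<Prod>q\<in>upper_pairs n. (A $$ q) powr (\<alpha> q)) \<le> c"
    using \<alpha> by (auto simp: bounded_ratios_def)
  define t where "t = (c + 1) powr (1 / s)"
  have t: "1 \<le> t" using c(1) s by (simp add: t_def ge_one_powr_ge_zero)
  then obtain A where A: "A \<in> X" "\<forall>q\<in>upper_pairs n. A $$ q = t powr w q"
    using curve[OF t] by (elim bexE) (rule that)
  have "(\<Prod>q\<in>upper_pairs n. (A $$ q) powr (\<alpha> q)) = (\<Prod>q\<in>upper_pairs n. (t powr w q) powr (\<alpha> q))"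
    using A(2) by (intro prod.cong) auto
  also have "\<dots> = exp (\<Sum>q\<in>upper_pairs n. \<alpha> q * ln (t powr w q))"
    using t by (intro prod_powr_eq_exp) auto
  also have "\<dots> = t powr s"
    using t by (simp add: s_def powr_def sum_distrib_right mult.assoc)
  also have "\<dots> = c + 1" using s c(1) by (simp add: t_def powr_powr)
  finally show False using c(2)[OF A(1)] by simp
qed

lemma rank_one_pos_lorentzian:
  fixes u :: "nat \<Rightarrow> real"
  assumes "\<And>a. 0 < u a"
  shows "mat n n (\<lambda>(a, b). u a * u b) \<in> pos_lorentzian_mats n"
proof -
  have "mat n n (\<lambda>(a, b). u a * (u b / 2) + u b * (u a / 2) - 2 * 0 * 0) \<in> lorentzian_mats n"
    by (rule lorentzian_gram[where Z = "\<lambda>_. 0"]) (simp add: assms less_imp_le)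
  moreover have "u a * (u b / 2) + u b * (u a / 2) - 2 * 0 * 0 = u a * u b" for a b by simp
  ultimately show ?thesis using assms by (simp add: pos_lorentzian_mats_def)
qed

lemma cut_pos_lorentzian:
  assumes t: "1 \<le> t"
  shows "mat n n (\<lambda>(a, b). if (a \<in> S) = (b \<in> S) then 1 else t) \<in> pos_lorentzian_mats n"
proof -
  \<comment> \<open>With X = 1 an entry is Y a + Y b - 2 Z a Z b. The values of \<open>Y\<close> are
    right except outside \<open>S\<close>, where they give 2 t - 1; \<open>Z\<close> subtracts 2 (t
    - 1) there, and its root needs t \<ge> 1.\<close>
  define Y where "Y a = (if a \<in> S then 1 / 2 else t - 1 / 2)" for a
  define Z where "Z a = (if a \<in> S then 0 else sqrt (t - 1))" for a
  have e: "1 * Y b + 1 * Y a - 2 * Z a * Z b = (if (a \<in> S) = (b \<in> S) then 1 else t)" for a b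
    using t by (simp add: Y_def Z_def mult.assoc algebra_simps)
  have "mat n n (\<lambda>(a, b). 1 * Y b + 1 * Y a - 2 * Z a * Z b) \<in> lorentzian_mats n"
    by (rule lorentzian_gram[where X = "\<lambda>_. 1"]) (use t in \<open>simp add: e[unfolded mult_1]\<close>)
  then show ?thesis unfolding e using t by (auto simp: pos_lorentzian_mats_def)
qed

text \<open>Scaling one coordinate by t or by 1/t keeps the matrix positive of rank one, so the
  exponent is nonpositive in both directions.\<close>

lemma bounded_ratio_star:
  assumes \<alpha>: "\<alpha> \<in> bounded_ratios n (pos_lorentzian_mats n)"
  shows "(\<Sum>q\<in>upper_pairs n. \<alpha> q * star x q) = 0"
proof -
  have le: "(\<Sum>q\<in>upper_pairs n. \<alpha> q * (e * star x q)) \<le> 0" for e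
  proof (rule bounded_ratio_monomial_curve[OF \<alpha>])
    fix t :: real assume t: "1 \<le> t"
    define u where "u a = (if a = x then t powr e else 1)" for a
    have "mat n n (\<lambda>(a, b). u a * u b) \<in> pos_lorentzian_mats n"
      by (rule rank_one_pos_lorentzian) (use t in \<open>simp add: u_def\<close>)
    moreover have "\<forall>q\<in>upper_pairs n. mat n n (\<lambda>(a, b). u a * u b) $$ q = t powr (e * star x q)"
      using t by (auto simp: upper_pairs_def star_def u_def powr_add[symmetric] mult_2_right)
    ultimately show "\<exists>A\<in>pos_lorentzian_mats n. \<forall>q\<in>upper_pairs n. A $$ q = t powr (e * star x q)" ..
  qed
  show ?thesis using le[of 1] le[of "-1"] by (simp add: sum_negf)
qed

lemma bounded_ratio_cut:
  assumes \<alpha>: "\<alpha> \<in> bounded_ratios n (pos_lorentzian_mats n)"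
  shows "(\<Sum>q\<in>upper_pairs n. \<alpha> q * cut S q) \<le> 0"
proof (rule bounded_ratio_monomial_curve[OF \<alpha>])
  fix t :: real assume t: "1 \<le> t"
  have "\<forall>q\<in>upper_pairs n. mat n n (\<lambda>(a, b). if (a \<in> S) = (b \<in> S) then 1 else t) $$ q = t powr cut S q"
    using t by (auto simp: upper_pairs_def cut_def)
  then show "\<exists>A\<in>pos_lorentzian_mats n. \<forall>q\<in>upper_pairs n. A $$ q = t powr cut S q"
    by (rule bexI) (rule cut_pos_lorentzian[OF t])
qed

lemma pentagonal_ratio_bounded:
  assumes A: "A \<in> pos_lorentzian_mats n" and lt: "i < n" "j < n" "k < n" "l < n" "m < n"
  shows "(\<Sum>q\<in>upper_pairs n. pentagonal_ratio i j k l m q * ln (A $$ q)) \<le> ln 4"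
proof -
  have L: "A \<in> lorentzian_mats n" and pos: "\<And>a b. a < n \<Longrightarrow> b < n \<Longrightarrow> 0 < A $$ (a, b)"
    using A by (auto simp: pos_lorentzian_mats_def)
  have W: "ln (A $$ (min a b, max a b)) = ln (A $$ (a, b))" if "a < n" "b < n" for a b
    using lorentzian_mats_symmetric[OF L that] by (simp add: min_def max_def)
  note pos = pos[OF lt(1) lt(2)] pos[OF lt(1) lt(3)] pos[OF lt(2) lt(3)] pos[OF lt(4) lt(4)]
    pos[OF lt(4) lt(5)] pos[OF lt(5) lt(5)] pos[OF lt(1) lt(4)] pos[OF lt(2) lt(4)] pos[OF lt(3) lt(4)]
    pos[OF lt(1) lt(5)] pos[OF lt(2) lt(5)] pos[OF lt(3) lt(5)]
  have "ln (A $$ (i, j) * A $$ (i, k) * A $$ (j, k) * A $$ (l, l) * A $$ (l, m) * A $$ (m, m))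
    \<le> ln (4 * (A $$ (i, l) * A $$ (j, l) * A $$ (k, l) * A $$ (i, m) * A $$ (j, m) * A $$ (k, m)))"
    using pentagonal_inequality[OF L lt] pos by (subst ln_le_cancel_iff) auto
  then show ?thesis
    unfolding sum_pentagonal_ratio[OF lt] by (simp only: W lt) (use pos in \<open>simp add: ln_mult\<close>)
qed

text \<open>This inclusion holds for every n, with bound 4 to the power of the sum of the
  coefficients; only the reverse one is special to five points.\<close>

lemma nonneg_cone_subset_bounded_ratios:
  "nonneg_cone {pentagonal_ratio i j k l m | i j k l m. i < n \<and> j < n \<and> k < n \<and> l < n \<and> m < n}
    \<subseteq> bounded_ratios n (pos_lorentzian_mats n)" (is "nonneg_cone ?S \<subseteq> _")
proof
  fix v assume "v \<in> nonneg_cone ?S"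
  then obtain F c where F: "finite F" "F \<subseteq> ?S" "\<forall>s\<in>F. 0 \<le> c s" and v: "v = (\<lambda>q. \<Sum>s\<in>F. c s * s q)"
    unfolding nonneg_cone_def by (elim CollectE exE conjE) (rule that)
  have out: "v q = 0" if "q \<notin> upper_pairs n" for q
    unfolding v
  proof (intro sum.neutral ballI)
    fix s assume "s \<in> F"
    then obtain i j k l m where "s = pentagonal_ratio i j k l m" "i < n" "j < n" "k < n" "l < n" "m < n"
      using F(2) by blast
    then show "c s * s q = 0" using that by (simp add: pentagonal_ratio_def basis_vec_outside)
  qed
  have "(\<Prod>q\<in>upper_pairs n. (A $$ q) powr (v q)) \<le> exp (\<Sum>s\<in>F. c s * ln 4)"
    if A: "A \<in> pos_lorentzian_mats n" for A
  proof -
    have "(\<Prod>q\<in>upper_pairs n. (A $$ q) powr (v q)) = exp (\<Sum>q\<in>upper_pairs n. v q * ln (A $$ q))"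
      by (rule prod_powr_eq_exp[OF finite_upper_pairs]) (use A in \<open>auto simp: pos_lorentzian_mats_def upper_pairs_def\<close>)
    also have "(\<Sum>q\<in>upper_pairs n. v q * ln (A $$ q)) = (\<Sum>q\<in>upper_pairs n. ln (A $$ q) * (\<Sum>s\<in>F. c s * s q))"
      unfolding v by (simp add: mult.commute)
    also have "\<dots> = (\<Sum>s\<in>F. c s * (\<Sum>q\<in>upper_pairs n. ln (A $$ q) * s q))"
      by (rule sum_mult_sum_swap)
    also have "\<dots> \<le> (\<Sum>s\<in>F. c s * ln 4)"
    proof (rule sum_mono)
      fix s assume s: "s \<in> F"
      then obtain i j k l m where "s = pentagonal_ratio i j k l m" "i < n" "j < n" "k < n" "l < n" "m < n"
        using F(2) by blast
      then have "(\<Sum>q\<in>upper_pairs n. ln (A $$ q) * s q) \<le> ln 4"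
        using pentagonal_ratio_bounded[OF A, of i j k l m] by (simp add: mult.commute)
      then show "c s * (\<Sum>q\<in>upper_pairs n. ln (A $$ q) * s q) \<le> c s * ln 4"
        using F(3) s by (intro mult_left_mono) auto
    qed
    finally show ?thesis by simp
  qed
  then show "v \<in> bounded_ratios n (pos_lorentzian_mats n)"
    using out unfolding bounded_ratios_def by (intro CollectI conjI allI impI exI[of _ "exp (\<Sum>s\<in>F. c s * ln 4)"]) auto
qed

theorem theoremA:
  fixes n :: nat
  assumes "0 < n"
  shows
    "(\<forall>p\<in>lorentzian_mats n. \<forall>i<n. \<forall>j<n. \<forall>k<n. \<forall>l<n. \<forall>m<n.
        p $$ (i, j) * p $$ (i, k) * p $$ (j, k) * p $$ (l, l) * p $$ (l, m) * p $$ (m, m)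
        \<le> 4 * (p $$ (i, l) * p $$ (j, l) * p $$ (k, l) * p $$ (i, m) * p $$ (j, m) * p $$ (k, m)))
   \<and> (\<forall>i<n. \<forall>j<n. \<forall>k<n. \<forall>l<n. \<forall>m<n. distinct [i, j, k, l, m] \<longrightarrow>
        (\<forall>c::real.
          (\<forall>p\<in>lorentzian_mats n.
            p $$ (i, j) * p $$ (i, k) * p $$ (j, k) * p $$ (l, l) * p $$ (l, m) * p $$ (m, m)
            \<le> c * (p $$ (i, l) * p $$ (j, l) * p $$ (k, l) * p $$ (i, m) * p $$ (j, m) * p $$ (k, m)))
          \<longrightarrow> 4 \<le> c))
   \<and> bounded_ratios 5 (pos_lorentzian_mats 5)
       = nonneg_cone {pentagonal_ratio i j k l m | i j k l m. i < 5 \<and> j < 5 \<and> k < 5 \<and> l < 5 \<and> m < 5}"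
proof (intro conjI subset_antisym nonneg_cone_subset_bounded_ratios ballI allI impI)
  show "p $$ (i, j) * p $$ (i, k) * p $$ (j, k) * p $$ (l, l) * p $$ (l, m) * p $$ (m, m)
        \<le> 4 * (p $$ (i, l) * p $$ (j, l) * p $$ (k, l) * p $$ (i, m) * p $$ (j, m) * p $$ (k, m))"
    if "p \<in> lorentzian_mats n" "i < n" "j < n" "k < n" "l < n" "m < n" for p i j k l m
    using that by (rule pentagonal_inequality)
next
  fix i j k l m and c :: real
  assume lt: "i < n" "j < n" "k < n" "l < n" "m < n" "distinct [i, j, k, l, m]"
    and c: "\<forall>p\<in>lorentzian_mats n.
            p $$ (i, j) * p $$ (i, k) * p $$ (j, k) * p $$ (l, l) * p $$ (l, m) * p $$ (m, m)
            \<le> c * (p $$ (i, l) * p $$ (j, l) * p $$ (k, l) * p $$ (i, m) * p $$ (j, m) * p $$ (k, m))"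
  show "4 \<le> c" by (rule pentagonal_constant_optimal[OF lt c[rule_format]])
next
  show "bounded_ratios 5 (pos_lorentzian_mats 5)
    \<subseteq> nonneg_cone {pentagonal_ratio i j k l m | i j k l m. i < 5 \<and> j < 5 \<and> k < 5 \<and> l < 5 \<and> m < 5}"
  proof
    fix \<alpha> assume \<alpha>: "\<alpha> \<in> bounded_ratios 5 (pos_lorentzian_mats 5)"
    have "\<And>q. q \<notin> upper_pairs 5 \<Longrightarrow> \<alpha> q = 0"
      using \<alpha> unfolding bounded_ratios_def mem_Collect_eq by (elim conjE allE impE)
    from this bounded_ratio_star[OF \<alpha>] bounded_ratio_cut[OF \<alpha>]
    show "\<alpha> \<in> nonneg_cone {pentagonal_ratio i j k l m | i j k l m. i < 5 \<and> j < 5 \<and> k < 5 \<and> l < 5 \<and> m < 5}"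
      by (rule pentagonal_cone_5)
  qed
qed

end
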